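(* Let $m\ge0$ be a real constant. Any 1-superenergy tensor $T^{\alpha\beta\gamma\delta}=T^{\alpha\beta\gamma\delta}[\phi]$ of the scalar field (that is, any tensor having properties P1, P2, P3 of the context) which is totally symmetric in its four indices is given by $$T^{\alpha\beta\gamma\delta}=k\,W^{\alpha\beta\gamma\delta},$$ where $k$ is an arbitrary real constant and $W^{\alpha\beta\gamma\delta}$ is defined by $$W^{\alpha\beta\gamma\delta}=T_1^{(\alpha\beta\gamma\delta)}=T_2^{(\alpha\beta\gamma\delta)}$$ (in particular these two total symmetrizations coincide). The tensor $W^{\alpha\beta\gamma\delta}$ may be written as $$W^{\alpha\beta\gamma\delta}=\tfrac13\left(\phi^{,\alpha\beta}\phi^{,\gamma\delta}+2\phi^{,\alpha(\gamma}\phi^{,\delta)\beta}\right)-\tfrac16\left(g^{\alpha\beta}\tau^{\gamma\delta}+g^{\gamma\delta}\tau^{\alpha\beta}+2g^{\alpha(\gamma}\tau^{\delta)\beta}+2g^{\beta(\gamma}\tau^{\delta)\alpha}\right).$$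
   Context: Setting: Minkowski spacetime $\mathbb{R}^4$ with Galilean coordinates $x^\alpha$ and metric $g_{\alpha\beta}=\mathrm{diag}(1,-1,-1,-1)$, used to raise and lower indices. Scalar fields $\phi$ are real and smooth; commas denote partial derivatives; $\Box=g^{\alpha\beta}\partial_\alpha\partial_\beta$. Round brackets denote symmetrization with weight one: $X^{(\alpha\beta)}=\frac12(X^{\alpha\beta}+X^{\beta\alpha})$, and $X^{(\alpha\beta\gamma\delta)}$ is the average over all 24 permutations of the indices. Define $$\tau^{\alpha\beta}=\phi^{,\alpha\lambda}{\phi^{,\beta}}_{\lambda}-m^2\phi^{,\alpha}\phi^{,\beta}-\tfrac12 K g^{\alpha\beta},\qquad K=\tfrac12\phi^{,\rho\sigma}\phi_{,\rho\sigma}-m^2\phi^{,\lambda}\phi_{,\lambda}+\tfrac12 m^4\phi^2,$$ $$T_1^{\alpha\beta\gamma\delta}=\phi^{,\alpha\beta}\phi^{,\gamma\delta}+\tfrac12\left(g^{\alpha\beta}\tau^{\gamma\delta}+g^{\gamma\delta}\tau^{\alpha\beta}\right)-g^{\alpha(\gamma}\tau^{\delta)\beta}-g^{\beta(\gamma}\tau^{\delta)\alpha},$$ $$T_2^{\alpha\beta\gamma\delta}=\phi^{,\alpha(\gamma}\phi^{,\delta)\beta}-\tfrac12\left(g^{\alpha\beta}\tau^{\gamma\delta}+g^{\gamma\delta}\tau^{\alpha\beta}\right).$$ A 1-superenergy tensor is a rank 4 tensor-valued expression $T^{\alpha\beta\gamma\delta}[\phi]$ satisfying: P1: $T^{\alpha\beta\gamma\delta}$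 is a sum of terms, each being a constant times a contraction, using metric components only, of $\phi\phi$, of $\phi^{,\mu}\phi^{,\nu}$, or of $\phi^{,\mu_1\mu_2}\phi^{,\nu_1\nu_2}$. P2: $T^{\alpha\beta\gamma\delta}=T^{\beta\alpha\gamma\delta}=T^{\alpha\beta\delta\gamma}$ and $T^{\alpha\beta\gamma\delta}=T^{\gamma\delta\alpha\beta}$. P3: ${T^{\alpha\beta\gamma\delta}}_{,\alpha}=0$ whenever $(\Box+m^2)\phi=0$. Precisely, the tensors satisfying P1 and P2 are taken to be those of the form $$\begin{aligned}T^{\alpha\beta\gamma\delta}={}&a\,\phi^{,\alpha\beta}\phi^{,\gamma\delta}+b\,\phi^{,\gamma(\alpha}\phi^{,\beta)\delta}+\tfrac12c_1\left(g^{\alpha\beta}\phi^{,\gamma\lambda}{\phi^{,\delta}}_{\lambda}+g^{\gamma\delta}\phi^{,\alpha\lambda}{\phi^{,\beta}}_{\lambda}\right)\\&+c_2\left(g^{\gamma(\alpha}\phi^{,\beta)\lambda}{\phi^{,\delta}}_{\lambda}+g^{\delta(\alpha}\phi^{,\beta)\lambda}{\phi^{,\gamma}}_{\lambda}\right)+\tfrac12d_1m^2\left(g^{\alpha\beta}\phi^{,\gamma}\phi^{,\delta}+g^{\gamma\delta}\phi^{,\alpha}\phi^{,\beta}\right)\\&+d_2m^2\left(g^{\gamma(\alpha}\phi^{,\beta)}\phi^{,\delta}+g^{\delta(\alpha}\phi^{,\beta)}\phi^{,\gamma}\right)+\tfrac12K_1g^{\alpha\beta}g^{\gamma\delta}+K_2\,g^{\gamma(\alpha}g^{\beta)\delta},\end{aligned}$$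 with $K_s=p_s\phi^{,\rho\sigma}\phi_{,\rho\sigma}+q_sm^2\phi^{,\lambda}\phi_{,\lambda}+r_sm^4\phi^2$ $(s=1,2)$ and real constants $a,b,c_s,d_s,p_s,q_s,r_s$. *)

theory Defs
  imports "HOL-Analysis.Analysis"
begin

text \<open>
  Tensor indices are elements of the type \<open>4\<close>, i.e. \<open>0, 1, 2, 3\<close>; the index \<open>0\<close> is the time
  direction. Points of Minkowski spacetime are given by their coordinates in \<open>real ^ 4\<close>.
\<close>

type_synonym scalar_field = "real ^ 4 \<Rightarrow> real"
type_synonym tensor2 = "4 \<Rightarrow> 4 \<Rightarrow> real"
type_synonym tensor4 = "4 \<Rightarrow> 4 \<Rightarrow> 4 \<Rightarrow> 4 \<Rightarrow> real"

text \<open>The matrix \<open>diag (1, -1, -1, -1)\<close> is its own inverse, so \<open>\<eta>\<close> stands for the metric with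
  lower indices as well as with upper indices.\<close>

definition eta :: tensor2 ("\<eta>") where
  "\<eta> \<alpha> \<beta> = (if \<alpha> = \<beta> then (if \<alpha> = 0 then 1 else -1) else 0)"

definition pd :: "4 \<Rightarrow> scalar_field \<Rightarrow> scalar_field" where
  "pd \<alpha> f x = deriv (\<lambda>t. f (x + t *\<^sub>R axis \<alpha> 1)) 0"

primrec iter_pd :: "4 list \<Rightarrow> scalar_field \<Rightarrow> scalar_field" where
  "iter_pd [] f = f"
| "iter_pd (\<alpha> # \<alpha>s) f = pd \<alpha> (iter_pd \<alpha>s f)"

text \<open>All iterated partial derivatives are (Frechet) differentiable, hence exist and are continuous
  to every order; this is the class of \<open>C\<close>-infinity functions.\<close>

definition smooth :: "scalar_field \<Rightarrow> bool" where
  "smooth f \<longleftrightarrow> (\<forall>\<alpha>s x. iter_pd \<alpha>s f differentiable (at x))"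

definition box :: "scalar_field \<Rightarrow> scalar_field" where
  "box \<phi> x = (\<Sum>\<alpha>\<in>UNIV. \<Sum>\<beta>\<in>UNIV. \<eta> \<alpha> \<beta> * pd \<alpha> (pd \<beta> \<phi>) x)"

text \<open>The suffixes \<open>l\<close> and \<open>u\<close> give the position (lower, upper) of the derivative indices.\<close>

definition D_l :: "scalar_field \<Rightarrow> real ^ 4 \<Rightarrow> 4 \<Rightarrow> real" where
  "D_l \<phi> x \<mu> = pd \<mu> \<phi> x"

definition D_u :: "scalar_field \<Rightarrow> real ^ 4 \<Rightarrow> 4 \<Rightarrow> real" where
  "D_u \<phi> x \<alpha> = (\<Sum>\<mu>\<in>UNIV. \<eta> \<alpha> \<mu> * D_l \<phi> x \<mu>)"

definition D_ll :: "scalar_field \<Rightarrow> real ^ 4 \<Rightarrow> tensor2" where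
  "D_ll \<phi> x \<mu> \<nu> = pd \<nu> (pd \<mu> \<phi>) x"

definition D_ul :: "scalar_field \<Rightarrow> real ^ 4 \<Rightarrow> tensor2" where
  "D_ul \<phi> x \<alpha> \<nu> = (\<Sum>\<mu>\<in>UNIV. \<eta> \<alpha> \<mu> * D_ll \<phi> x \<mu> \<nu>)"

definition D_uu :: "scalar_field \<Rightarrow> real ^ 4 \<Rightarrow> tensor2" where
  "D_uu \<phi> x \<alpha> \<beta> = (\<Sum>\<mu>\<in>UNIV. \<Sum>\<nu>\<in>UNIV. \<eta> \<alpha> \<mu> * \<eta> \<beta> \<nu> * D_ll \<phi> x \<mu> \<nu>)"

text \<open>\<open>\<phi>\<^sup>,\<^sup>\<alpha>\<^sup>\<kappa> \<phi>\<^sup>,\<^sup>\<beta>\<^sub>\<kappa>\<close>, \<open>\<phi>\<^sup>,\<^sup>\<rho>\<^sup>\<sigma> \<phi>\<^sub>,\<^sub>\<rho>\<^sub>\<sigma>\<close> and \<open>\<phi>\<^sup>,\<^sup>\<kappa> \<phi>\<^sub>,\<^sub>\<kappa>\<close>:\<close>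

definition hess_sq :: "scalar_field \<Rightarrow> real ^ 4 \<Rightarrow> tensor2" where
  "hess_sq \<phi> x \<alpha> \<beta> = (\<Sum>\<kappa>\<in>UNIV. D_uu \<phi> x \<alpha> \<kappa> * D_ul \<phi> x \<beta> \<kappa>)"

definition hess_norm :: "scalar_field \<Rightarrow> real ^ 4 \<Rightarrow> real" where
  "hess_norm \<phi> x = (\<Sum>\<rho>\<in>UNIV. \<Sum>\<sigma>\<in>UNIV. D_uu \<phi> x \<rho> \<sigma> * D_ll \<phi> x \<rho> \<sigma>)"

definition grad_norm :: "scalar_field \<Rightarrow> real ^ 4 \<Rightarrow> real" where
  "grad_norm \<phi> x = (\<Sum>\<kappa>\<in>UNIV. D_u \<phi> x \<kappa> * D_l \<phi> x \<kappa>)"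

text \<open>Symmetrizations have weight one. An expression such as \<open>g\<^sup>\<alpha>\<^sup>(\<^sup>\<gamma> \<tau>\<^sup>\<delta>\<^sup>)\<^sup>\<beta>\<close> is written
  \<open>sym2 (\<lambda>i j. \<eta> \<alpha> i * \<tau> j \<beta>) \<gamma> \<delta>\<close>.\<close>

definition sym2 :: "tensor2 \<Rightarrow> tensor2" where
  "sym2 X \<alpha> \<beta> = (X \<alpha> \<beta> + X \<beta> \<alpha>) / 2"

text \<open>The tensor with its four argument slots permuted by \<open>\<pi>\<close>.\<close>

definition permute_slots :: "(nat \<Rightarrow> nat) \<Rightarrow> tensor4 \<Rightarrow> tensor4" where
  "permute_slots \<pi> X \<alpha> \<beta> \<gamma> \<delta> =
     (let i = (\<lambda>n. [\<alpha>, \<beta>, \<gamma>, \<delta>] ! \<pi> n) in X (i 0) (i 1) (i 2) (i 3))"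

definition sym4 :: "tensor4 \<Rightarrow> tensor4" where
  "sym4 X \<alpha> \<beta> \<gamma> \<delta> = (\<Sum>\<pi> | \<pi> permutes {..<4}. permute_slots \<pi> X \<alpha> \<beta> \<gamma> \<delta>) / 24"

definition totally_symmetric :: "tensor4 \<Rightarrow> bool" where
  "totally_symmetric X \<longleftrightarrow> (\<forall>\<pi>. \<pi> permutes {..<4} \<longrightarrow> permute_slots \<pi> X = X)"

definition K :: "real \<Rightarrow> scalar_field \<Rightarrow> real ^ 4 \<Rightarrow> real" where
  "K m \<phi> x = hess_norm \<phi> x / 2 - m^2 * grad_norm \<phi> x + m^4 * (\<phi> x)^2 / 2"

definition tau :: "real \<Rightarrow> scalar_field \<Rightarrow> real ^ 4 \<Rightarrow> tensor2" where
  "tau m \<phi> x \<alpha> \<beta> =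
     hess_sq \<phi> x \<alpha> \<beta> - m^2 * D_u \<phi> x \<alpha> * D_u \<phi> x \<beta> - K m \<phi> x * \<eta> \<alpha> \<beta> / 2"

definition T1 :: "real \<Rightarrow> scalar_field \<Rightarrow> real ^ 4 \<Rightarrow> tensor4" where
  "T1 m \<phi> x \<alpha> \<beta> \<gamma> \<delta> =
     D_uu \<phi> x \<alpha> \<beta> * D_uu \<phi> x \<gamma> \<delta>
     + (\<eta> \<alpha> \<beta> * tau m \<phi> x \<gamma> \<delta> + \<eta> \<gamma> \<delta> * tau m \<phi> x \<alpha> \<beta>) / 2
     - sym2 (\<lambda>i j. \<eta> \<alpha> i * tau m \<phi> x j \<beta>) \<gamma> \<delta>
     - sym2 (\<lambda>i j. \<eta> \<beta> i * tau m \<phi> x j \<alpha>) \<gamma> \<delta>"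

definition T2 :: "real \<Rightarrow> scalar_field \<Rightarrow> real ^ 4 \<Rightarrow> tensor4" where
  "T2 m \<phi> x \<alpha> \<beta> \<gamma> \<delta> =
     sym2 (\<lambda>i j. D_uu \<phi> x \<alpha> i * D_uu \<phi> x j \<beta>) \<gamma> \<delta>
     - (\<eta> \<alpha> \<beta> * tau m \<phi> x \<gamma> \<delta> + \<eta> \<gamma> \<delta> * tau m \<phi> x \<alpha> \<beta>) / 2"

definition W :: "real \<Rightarrow> scalar_field \<Rightarrow> real ^ 4 \<Rightarrow> tensor4" where
  "W m \<phi> x = sym4 (T1 m \<phi> x)"

definition Kgen :: "real \<Rightarrow> real \<Rightarrow> real \<Rightarrow> real \<Rightarrow> scalar_field \<Rightarrow> real ^ 4 \<Rightarrow> real" where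
  "Kgen m p q r \<phi> x = p * hess_norm \<phi> x + q * m^2 * grad_norm \<phi> x + r * m^4 * (\<phi> x)^2"

text \<open>
  A tensor-valued expression is a map \<open>T\<close> from scalar fields to tensor fields; only its values on
  smooth fields are relevant. The first predicate says that \<open>T\<close> is quadratic with constant
  coefficients in the field or its first or second derivatives (contracted with the metric) and has
  the symmetries \<open>T\<^sup>\<alpha>\<^sup>\<beta>\<^sup>\<gamma>\<^sup>\<delta> = T\<^sup>\<beta>\<^sup>\<alpha>\<^sup>\<gamma>\<^sup>\<delta> = T\<^sup>\<alpha>\<^sup>\<beta>\<^sup>\<delta>\<^sup>\<gamma> = T\<^sup>\<gamma>\<^sup>\<delta>\<^sup>\<alpha>\<^sup>\<beta>\<close>; by convention this means that it has the
  general form below (traces \<open>box \<phi>\<close> of the second derivatives are not among the terms).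
\<close>

definition quadratic_form :: "real \<Rightarrow> (scalar_field \<Rightarrow> real ^ 4 \<Rightarrow> tensor4) \<Rightarrow> bool" where
  "quadratic_form m T \<longleftrightarrow>
     (\<exists>a b c1 c2 d1 d2 p1 q1 r1 p2 q2 r2 :: real.
       \<forall>\<phi> x \<alpha> \<beta> \<gamma> \<delta>. smooth \<phi> \<longrightarrow>
         T \<phi> x \<alpha> \<beta> \<gamma> \<delta> =
           a * D_uu \<phi> x \<alpha> \<beta> * D_uu \<phi> x \<gamma> \<delta>
           + b * sym2 (\<lambda>i j. D_uu \<phi> x \<gamma> i * D_uu \<phi> x j \<delta>) \<alpha> \<beta>
           + c1 / 2 * (\<eta> \<alpha> \<beta> * hess_sq \<phi> x \<gamma> \<delta> + \<eta> \<gamma> \<delta> * hess_sq \<phi> x \<alpha> \<beta>)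
           + c2 * (sym2 (\<lambda>i j. \<eta> \<gamma> i * hess_sq \<phi> x j \<delta>) \<alpha> \<beta>
                   + sym2 (\<lambda>i j. \<eta> \<delta> i * hess_sq \<phi> x j \<gamma>) \<alpha> \<beta>)
           + d1 / 2 * m^2 * (\<eta> \<alpha> \<beta> * D_u \<phi> x \<gamma> * D_u \<phi> x \<delta>
                             + \<eta> \<gamma> \<delta> * D_u \<phi> x \<alpha> * D_u \<phi> x \<beta>)
           + d2 * m^2 * (sym2 (\<lambda>i j. \<eta> \<gamma> i * D_u \<phi> x j * D_u \<phi> x \<delta>) \<alpha> \<beta>
                         + sym2 (\<lambda>i j. \<eta> \<delta> i * D_u \<phi> x j * D_u \<phi> x \<gamma>) \<alpha> \<beta>)
           + Kgen m p1 q1 r1 \<phi> x / 2 * \<eta> \<alpha> \<beta> * \<eta> \<gamma> \<delta>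
           + Kgen m p2 q2 r2 \<phi> x * sym2 (\<lambda>i j. \<eta> \<gamma> i * \<eta> j \<delta>) \<alpha> \<beta>)"

definition conserved :: "real \<Rightarrow> (scalar_field \<Rightarrow> real ^ 4 \<Rightarrow> tensor4) \<Rightarrow> bool" where
  "conserved m T \<longleftrightarrow>
     (\<forall>\<phi>. smooth \<phi> \<longrightarrow> (\<forall>x. box \<phi> x + m^2 * \<phi> x = 0) \<longrightarrow>
       (\<forall>x \<beta> \<gamma> \<delta>. (\<Sum>\<alpha>\<in>UNIV. pd \<alpha> (\<lambda>y. T \<phi> y \<alpha> \<beta> \<gamma> \<delta>) x) = 0))"

definition superenergy_tensor :: "real \<Rightarrow> (scalar_field \<Rightarrow> real ^ 4 \<Rightarrow> tensor4) \<Rightarrow> bool" where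
  "superenergy_tensor m T \<longleftrightarrow> quadratic_form m T \<and> conserved m T"

end

theory Submission
  imports Defs
begin

text \<open>
  Averaging a totally symmetric tensor of the general quadratic form over the slots collapses it to
  a combination of the symmetrized products \<open>\<phi>\<phi>\<close> of second derivatives, \<open>gH\<close> (\<open>H\<close> the square of the
  Hessian), \<open>gBB\<close> (\<open>B\<close> the gradient) and \<open>gg\<close>. On solutions of the Klein-Gordon equation its divergence
  is a combination of five kinds of terms, whose coefficients (with their powers of \<open>m\<close>) all vanish
  exactly for the multiples of \<open>W\<close>. That they must vanish is seen on the explicit solutions
  \<open>cosh (k \<bullet> x) + sinh (l \<bullet> x)\<close> with \<open>k\<close> and \<open>l\<close> on the mass shell.
\<close>

section \<open>Partial derivatives\<close>

text \<open>Total symmetry is never turned into equations between the twelve constants of the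
  general form; such equations would need an independence argument of their own. Since T equals its
  average over the slots, averaging computes the six surviving constants outright, and only
  conservation has to be solved. The resulting system is triangular: \<open>a\<close> stays free,
  the terms without a metric factor fix \<open>c\<close> and \<open>d\<close>, and the terms with
  one then fix \<open>p\<close>, \<open>q\<close> and \<open>r\<close>. The last three constants of
  mass dimension enter only through \<open>d * m\<^sup>2\<close>, \<open>q * m\<^sup>2\<close> and
  \<open>r * m ^ 4\<close>; for m = 0 they are themselves undetermined, so the argument works with
  the products throughout. The test solutions are hyperbolic because this puts the wave vectors on
  the shell \<open>minkowski k k = - m\<^sup>2\<close>, which contains purely spatial vectors, so
  that orthogonal pairs are easy to write down. Smoothness is phrased through iterated partial
  derivatives, hence the symmetry of the Hessian has to be proved as well.\<close>

lemma has_derivative_line: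
  assumes "(f has_derivative f') (at (x + t *\<^sub>R axis \<alpha> 1))"
  shows "((\<lambda>t. f (x + t *\<^sub>R axis \<alpha> 1)) has_real_derivative f' (axis \<alpha> 1)) (at t)"
proof -
  interpret f': bounded_linear f'
    using assms by (rule has_derivative_bounded_linear)
  have "((\<lambda>t. x + t *\<^sub>R axis \<alpha> 1) has_derivative (\<lambda>s. s *\<^sub>R axis \<alpha> 1)) (at t)"
    by (auto intro!: derivative_eq_intros)
  from has_derivative_compose[OF this assms] show ?thesis
    by (simp add: f'.scaleR has_field_derivative_def mult_commute_abs)
qed

lemma pd_eqI:
  assumes "((\<lambda>t. f (x + t *\<^sub>R axis \<alpha> 1)) has_real_derivative D) (at 0)"
  shows "pd \<alpha> f x = D"
  unfolding pd_def by (rule DERIV_imp_deriv[OF assms])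

lemma pd_eq_derivative:
  assumes "(f has_derivative f') (at x)"
  shows "pd \<alpha> f x = f' (axis \<alpha> 1)"
  by (intro pd_eqI has_derivative_line) (simp add: assms)

lemma has_real_derivative_pd:
  assumes "f differentiable (at (x + t *\<^sub>R axis \<alpha> 1))"
  shows "((\<lambda>t. f (x + t *\<^sub>R axis \<alpha> 1)) has_real_derivative pd \<alpha> f (x + t *\<^sub>R axis \<alpha> 1)) (at t)"
  using assms has_derivative_line pd_eq_derivative unfolding differentiable_def by metis

text \<open>The second difference quotient is symmetric in the two directions, so its limit yields the
  symmetry of second partial derivatives.\<close>

lemma second_difference_tendsto:
  assumes f: "\<And>y. f differentiable (at y)" and df: "pd \<alpha> f differentiable (at x)"
  shows "((\<lambda>h. (f (x + h *\<^sub>R axis \<alpha> 1 + h *\<^sub>R axis \<beta> 1) - f (x + h *\<^sub>R axis \<alpha> 1)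
            - f (x + h *\<^sub>R axis \<beta> 1) + f x) / h\<^sup>2) \<longlongrightarrow> pd \<beta> (pd \<alpha> f) x) (at_right 0)"
proof -
  let ?a = "axis \<alpha> 1 :: real ^ 4" and ?b = "axis \<beta> 1 :: real ^ 4"
  let ?\<Delta> = "\<lambda>h. f (x + h *\<^sub>R ?a + h *\<^sub>R ?b) - f (x + h *\<^sub>R ?a) - f (x + h *\<^sub>R ?b) + f x"
  define g where "g = pd \<alpha> f"
  obtain D where D: "(g has_derivative D) (at x)"
    using df unfolding g_def differentiable_def by blast
  then interpret D: bounded_linear D
    by (rule has_derivative_bounded_linear)
  have pd_g: "pd \<beta> g x = D ?b"
    by (rule pd_eq_derivative[OF D])
  have "\<exists>d>0. \<forall>h>0. h < d \<longrightarrow> \<bar>?\<Delta> h / h\<^sup>2 - D ?b\<bar> < e" if "e > 0" for e :: real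
  proof -
    \<comment> \<open>The share \<open>e / 4\<close> is chosen for the final count: the two points
      used below lie within 2h and h of x, so the errors add up to at most 3/4 of
      \<open>e * h\<close>. The bound \<open>h < d / 2\<close> keeps both points inside the ball of
      radius d.\<close>
    obtain d where d: "d > 0"
      "\<And>y. norm (y - x) < d \<Longrightarrow> norm (g y - g x - D (y - x)) \<le> e / 4 * norm (y - x)"
      using D \<open>e > 0\<close> unfolding has_derivative_at_alt
      by (metis divide_pos_pos zero_less_numeral)
    have "\<bar>?\<Delta> h / h\<^sup>2 - D ?b\<bar> < e" if h: "0 < h" "h < d / 2" for h
    proof -
      \<comment> \<open>The mean value theorem in direction \<alpha>, applied to the difference of f
        along two parallel lines, turns the second difference into h times a first difference of
        \<open>g\<close>. The unknown z then cancels, because the linear parts at the two points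
        differ exactly by \<open>h * D ?b\<close>. Neither point need lie on the \<beta>-axis line
        through x, which is why Frechet differentiability of \<open>g\<close> is used.\<close>
      let ?u = "\<lambda>t. f (x + h *\<^sub>R ?b + t *\<^sub>R ?a) - f (x + t *\<^sub>R ?a)"
      have "\<exists>z>0. z < h \<and> ?u h - ?u 0
          = (h - 0) * (g (x + h *\<^sub>R ?b + z *\<^sub>R ?a) - g (x + z *\<^sub>R ?a))"
        unfolding g_def by (intro MVT2 h DERIV_diff has_real_derivative_pd f)
      then obtain z where z: "0 < z" "z < h"
        and \<Delta>: "?\<Delta> h = h * (g (x + h *\<^sub>R ?b + z *\<^sub>R ?a) - g (x + z *\<^sub>R ?a))"
        by (auto simp: add_ac)
      let ?v = "h *\<^sub>R ?b + z *\<^sub>R ?a" and ?w = "z *\<^sub>R ?a"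
      have v: "norm ?v \<le> h + z" and w: "norm ?w = z"
        using norm_triangle_ineq[of "h *\<^sub>R ?b" "z *\<^sub>R ?a"] z h by (auto simp: norm_axis_1)
      have ev: "\<bar>g (x + ?v) - g x - D ?v\<bar> \<le> e / 4 * norm ?v"
        using d(2)[of "x + ?v"] v z h by simp
      have ew: "\<bar>g (x + ?w) - g x - D ?w\<bar> \<le> e / 4 * norm ?w"
        using d(2)[of "x + ?w"] w z h by simp
      have "norm ?v \<le> 2 * h" "norm ?w \<le> h"
        using v w z by auto
      then have "e / 4 * norm ?v \<le> e / 4 * (2 * h)" "e / 4 * norm ?w \<le> e / 4 * h"
        using \<open>e > 0\<close> by (auto intro!: mult_left_mono)
      moreover have "D ?v - D ?w = h * D ?b"
        by (simp add: D.add D.scaleR)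
      ultimately have "\<bar>g (x + ?v) - g (x + ?w) - h * D ?b\<bar> \<le> e / 4 * (3 * h)"
        using ev ew by linarith
      also have "\<dots> < e * h"
        using \<open>e > 0\<close> h by simp
      finally have "\<bar>g (x + ?v) - g (x + ?w) - h * D ?b\<bar> / h < e"
        using h by (simp add: pos_divide_less_eq)
      moreover have "?\<Delta> h / h\<^sup>2 - D ?b = (g (x + ?v) - g (x + ?w) - h * D ?b) / h"
        unfolding \<Delta> using h by (simp add: power2_eq_square field_simps)
      ultimately show ?thesis
        using h by simp
    qed
    then show ?thesis
      using d(1) by (intro exI[of _ "d / 2"]) auto
  qed
  then show ?thesis
    unfolding tendsto_iff eventually_at_right_field pd_g[unfolded g_def] dist_real_def by blast
qed

lemma smooth_differentiable: "smooth f \<Longrightarrow> f differentiable (at x)"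
  unfolding smooth_def by (metis iter_pd.simps(1))

lemma iter_pd_append: "iter_pd (\<alpha>s @ \<beta>s) f = iter_pd \<alpha>s (iter_pd \<beta>s f)"
  by (induction \<alpha>s) auto

lemma smooth_pd: "smooth f \<Longrightarrow> smooth (pd \<alpha> f)"
  unfolding smooth_def using iter_pd_append[of _ "[\<alpha>]" f] by simp metis

lemma pd_commute:
  assumes "smooth f"
  shows "pd \<alpha> (pd \<beta> f) x = pd \<beta> (pd \<alpha> f) x"
proof -
  let ?\<Delta> = "\<lambda>\<alpha> \<beta> h. (f (x + h *\<^sub>R axis \<alpha> 1 + h *\<^sub>R axis \<beta> 1) - f (x + h *\<^sub>R axis \<alpha> 1)
            - f (x + h *\<^sub>R axis \<beta> 1) + f x) / h\<^sup>2"
  have "(?\<Delta> \<alpha> \<beta> \<longlongrightarrow> pd \<beta> (pd \<alpha> f) x) (at_right 0)" "(?\<Delta> \<beta> \<alpha> \<longlongrightarrow> pd \<alpha> (pd \<beta> f) x) (at_right 0)"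
    by (intro second_difference_tendsto smooth_differentiable smooth_pd assms)+
  moreover have "?\<Delta> \<beta> \<alpha> = ?\<Delta> \<alpha> \<beta>"
    by (simp add: algebra_simps)
  ultimately show ?thesis
    using tendsto_unique[OF trivial_limit_at_right_real] by auto
qed

section \<open>Symmetrization\<close>

lemma sum_permutations_left:
  assumes "\<sigma> permutes S"
  shows "(\<Sum>\<pi> | \<pi> permutes S. f (\<sigma> \<circ> \<pi>)) = (\<Sum>\<pi> | \<pi> permutes S. f \<pi>)"
proof -
  have "inj_on ((\<circ>) \<sigma>) {\<pi>. \<pi> permutes S}"
    using permutes_inj[OF assms] by (auto intro!: inj_onI simp: fun_eq_iff inj_eq)
  then have "(\<Sum>\<pi>\<in>(\<circ>) \<sigma> ` {\<pi>. \<pi> permutes S}. f \<pi>) = (\<Sum>\<pi> | \<pi> permutes S. f (\<sigma> \<circ> \<pi>))"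
    by (simp add: sum.reindex)
  then show ?thesis
    using image_compose_permutations_left[OF assms] by (simp add: image_def setcompr_eq_image)
qed

text \<open>Each permutation of the four slots factors uniquely into transpositions moving 0, then
  1, then 2 to a slot not below it. This yields 4 * 3 * 2 explicit terms, which simplification can
  evaluate.\<close>

lemma sum_permutes_4:
  fixes f :: "(nat \<Rightarrow> nat) \<Rightarrow> real"
  shows "(\<Sum>\<pi> | \<pi> permutes {..<4}. f \<pi>)
    = (\<Sum>a\<in>{0,1,2,3}. \<Sum>b\<in>{1,2,3}. \<Sum>c\<in>{2,3}. f (Transposition.transpose 0 a \<circ> (Transposition.transpose 1 b \<circ> Transposition.transpose 2 c)))"
proof -
  have S: "{..<4} = {0, 1, 2, 3 :: nat}"
    by auto
  have 3: "(\<Sum>q | q permutes {3}. g q) = g id" for g :: "(nat \<Rightarrow> nat) \<Rightarrow> real"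
  proof -
    have "{q. q permutes {3::nat}} = {id}"
      by (auto simp only: permutes_sing)
    then show ?thesis by simp
  qed
  have 2: "(\<Sum>q | q permutes {2, 3}. g q) = (\<Sum>c\<in>{2,3}. g (Transposition.transpose 2 c))"
    for g :: "(nat \<Rightarrow> nat) \<Rightarrow> real"
    by (subst sum_over_permutations_insert) (simp_all only: 3 o_id, simp_all)
  have 1: "(\<Sum>q | q permutes {1, 2, 3}. g q)
     = (\<Sum>b\<in>{1,2,3}. \<Sum>c\<in>{2,3}. g (Transposition.transpose 1 b \<circ> Transposition.transpose 2 c))"
    for g :: "(nat \<Rightarrow> nat) \<Rightarrow> real"
    by (subst sum_over_permutations_insert) (simp_all only: 2, simp_all)
  show ?thesis
    unfolding S by (subst sum_over_permutations_insert) (simp_all only: 1, simp_all)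
qed

text \<open>The three symmetries generate a dihedral group of order 8, so the 24 summands fall into
  3 classes of 8 equal ones. The classes correspond to the three ways of pairing up the four
  slots.\<close>

lemma sym4_eq:
  assumes "\<And>\<alpha> \<beta> \<gamma> \<delta>. X \<beta> \<alpha> \<gamma> \<delta> = X \<alpha> \<beta> \<gamma> \<delta>"
    and "\<And>\<alpha> \<beta> \<gamma> \<delta>. X \<alpha> \<beta> \<delta> \<gamma> = X \<alpha> \<beta> \<gamma> \<delta>"
    and "\<And>\<alpha> \<beta> \<gamma> \<delta>. X \<gamma> \<delta> \<alpha> \<beta> = X \<alpha> \<beta> \<gamma> \<delta>"
  shows "sym4 X \<alpha> \<beta> \<gamma> \<delta> = (X \<alpha> \<beta> \<gamma> \<delta> + X \<alpha> \<gamma> \<beta> \<delta> + X \<alpha> \<delta> \<beta> \<gamma>) / 3"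
proof -
  show ?thesis
    unfolding sym4_def sum_permutes_4
    by (simp add: permute_slots_def Let_def Transposition.transpose_def assms)
qed

text \<open>Trivial in content, but it lets the general quadratic form be replaced by its average
  over the three pairings. Exchanging the middle two and the last two slots suffices.\<close>

lemma totally_symmetric_average:
  assumes "totally_symmetric X"
  shows "X \<alpha> \<beta> \<gamma> \<delta> = (X \<alpha> \<beta> \<gamma> \<delta> + X \<alpha> \<gamma> \<beta> \<delta> + X \<alpha> \<delta> \<beta> \<gamma>) / 3"
proof -
  have "permute_slots (Transposition.transpose i j) X = X" if "i < 4" "j < 4" for i j
    using assms that unfolding totally_symmetric_def by (simp add: permutes_swap_id)
  then have *: "permute_slots (Transposition.transpose i j) X \<alpha> \<beta> \<gamma> \<delta> = X \<alpha> \<beta> \<gamma> \<delta>"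
    if "i < 4" "j < 4" for i j \<alpha> \<beta> \<gamma> \<delta>
    using that by simp
  have "X \<alpha> \<gamma> \<beta> \<delta> = X \<alpha> \<beta> \<gamma> \<delta>" for \<alpha> \<beta> \<gamma> \<delta>
    using *[of 1 2 \<alpha> \<beta> \<gamma> \<delta>] by (simp add: permute_slots_def Let_def Transposition.transpose_def)
  moreover have "X \<alpha> \<beta> \<delta> \<gamma> = X \<alpha> \<beta> \<gamma> \<delta>" for \<alpha> \<beta> \<gamma> \<delta>
    using *[of 2 3 \<alpha> \<beta> \<gamma> \<delta>] by (simp add: permute_slots_def Let_def Transposition.transpose_def)
  ultimately have "X \<alpha> \<gamma> \<beta> \<delta> = X \<alpha> \<beta> \<gamma> \<delta>" "X \<alpha> \<delta> \<beta> \<gamma> = X \<alpha> \<beta> \<gamma> \<delta>"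
    by metis+
  then show ?thesis
    by simp
qed

lemma totally_symmetric_sym4: "totally_symmetric (sym4 X)"
  unfolding totally_symmetric_def
proof (intro allI impI ext)
  fix \<sigma> :: "nat \<Rightarrow> nat" and \<alpha> \<beta> \<gamma> \<delta> :: 4
  assume \<sigma>: "\<sigma> permutes {..<4}"
  let ?i = "\<lambda>n. [\<alpha>, \<beta>, \<gamma>, \<delta>] ! n"
  have nth: "[f 0, f 1, f 2, f 3] ! n = f n" if "n < 4" for f :: "nat \<Rightarrow> 4" and n
    using that by (auto simp: less_Suc_eq numeral_eq_Suc)
  have lt: "\<pi> n < 4" if "\<pi> permutes {..<4}" "n < 4" for \<pi> and n :: nat
    using permutes_in_image[OF that(1), of n] that(2) by auto
  have "permute_slots \<sigma> (sym4 X) \<alpha> \<beta> \<gamma> \<delta> =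
    (\<Sum>\<pi> | \<pi> permutes {..<4}. permute_slots \<pi> X (?i (\<sigma> 0)) (?i (\<sigma> 1)) (?i (\<sigma> 2)) (?i (\<sigma> 3))) / 24"
    by (simp add: permute_slots_def[of \<sigma>] sym4_def)
  \<comment> \<open>Permuting by \<sigma> turns the summand of \<pi> into that of
    \<open>\<sigma> \<circ> \<pi>\<close>, and left multiplication by \<sigma> only reorders the
    sum.\<close>
  also have "(\<Sum>\<pi> | \<pi> permutes {..<4}. permute_slots \<pi> X (?i (\<sigma> 0)) (?i (\<sigma> 1)) (?i (\<sigma> 2)) (?i (\<sigma> 3)))
    = (\<Sum>\<pi> | \<pi> permutes {..<4}. permute_slots (\<sigma> \<circ> \<pi>) X \<alpha> \<beta> \<gamma> \<delta>)"
    by (intro sum.cong refl)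
      (simp add: permute_slots_def Let_def lt nth[of _ "\<lambda>n. ?i (\<sigma> n)", simplified] del: nth_Cons_numeral)
  also have "\<dots> = (\<Sum>\<pi> | \<pi> permutes {..<4}. permute_slots \<pi> X \<alpha> \<beta> \<gamma> \<delta>)"
    using sum_permutations_left[OF \<sigma>, of "\<lambda>\<pi>. permute_slots \<pi> X \<alpha> \<beta> \<gamma> \<delta>"] by simp
  finally show "permute_slots \<sigma> (sym4 X) \<alpha> \<beta> \<gamma> \<delta> = sym4 X \<alpha> \<beta> \<gamma> \<delta>"
    by (simp add: sym4_def[of X \<alpha>])
qed

section \<open>Index calculus\<close>

lemma eta_sym: "\<eta> \<alpha> \<beta> = \<eta> \<beta> \<alpha>"
  by (simp add: eta_def)

lemma eta_diag_mult_self [simp]: "\<eta> \<alpha> \<alpha> * \<eta> \<alpha> \<alpha> = 1" "\<eta> \<alpha> \<alpha> * (\<eta> \<alpha> \<alpha> * c) = c"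
  by (simp_all add: eta_def)

lemma sum_eta: "(\<Sum>\<mu>\<in>UNIV. \<eta> \<alpha> \<mu> * X \<mu>) = \<eta> \<alpha> \<alpha> * X \<alpha>"
proof -
  have "(\<Sum>\<mu>\<in>UNIV. \<eta> \<alpha> \<mu> * X \<mu>) = (\<Sum>\<mu>\<in>UNIV. if \<mu> = \<alpha> then \<eta> \<alpha> \<alpha> * X \<alpha> else 0)"
    by (intro sum.cong) (auto simp: eta_def)
  then show ?thesis by simp
qed

text \<open>The sign \<open>\<eta> \<alpha> \<alpha>\<close> lowers an index of
  \<open>\<eta> \<alpha> \<beta>\<close>, giving a Kronecker delta. In a divergence this renames the
  differentiated index wherever a metric factor carries it.\<close>

lemma sum_eta_contract: "(\<Sum>\<alpha>\<in>UNIV. \<eta> \<alpha> \<alpha> * (\<eta> \<alpha> \<beta> * X \<alpha>)) = X \<beta>"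
proof -
  have "(\<Sum>\<alpha>\<in>UNIV. \<eta> \<alpha> \<alpha> * (\<eta> \<alpha> \<beta> * X \<alpha>)) = (\<Sum>\<alpha>\<in>UNIV. if \<alpha> = \<beta> then X \<beta> else 0)"
    by (intro sum.cong) (auto simp: eta_def)
  then show ?thesis by simp
qed

lemma D_u_eq: "D_u \<phi> x \<alpha> = \<eta> \<alpha> \<alpha> * pd \<alpha> \<phi> x"
  by (simp add: D_u_def D_l_def sum_eta)

lemma D_ul_eq: "D_ul \<phi> x \<alpha> \<nu> = \<eta> \<alpha> \<alpha> * pd \<nu> (pd \<alpha> \<phi>) x"
  by (simp add: D_ul_def D_ll_def sum_eta)

lemma D_uu_eq: "D_uu \<phi> x \<alpha> \<beta> = \<eta> \<alpha> \<alpha> * \<eta> \<beta> \<beta> * pd \<beta> (pd \<alpha> \<phi>) x"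
  by (simp add: D_uu_def D_ll_def sum_eta mult.assoc flip: sum_distrib_left)

definition D_uuu :: "scalar_field \<Rightarrow> real ^ 4 \<Rightarrow> 4 \<Rightarrow> tensor2" where
  "D_uuu \<phi> x \<alpha> \<beta> \<gamma> = \<eta> \<alpha> \<alpha> * \<eta> \<beta> \<beta> * \<eta> \<gamma> \<gamma> * pd \<gamma> (pd \<beta> (pd \<alpha> \<phi>)) x"

lemma D_uu_commute: "smooth \<phi> \<Longrightarrow> D_uu \<phi> x \<alpha> \<beta> = D_uu \<phi> x \<beta> \<alpha>"
  by (simp add: D_uu_eq pd_commute[of \<phi> \<alpha> \<beta>])

lemma D_uuu_commute:
  assumes "smooth \<phi>"
  shows "D_uuu \<phi> x \<alpha> \<beta> \<gamma> = D_uuu \<phi> x \<beta> \<alpha> \<gamma>" "D_uuu \<phi> x \<alpha> \<beta> \<gamma> = D_uuu \<phi> x \<alpha> \<gamma> \<beta>"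
proof -
  have "pd \<beta> (pd \<alpha> \<phi>) = pd \<alpha> (pd \<beta> \<phi>)"
    using pd_commute[OF assms] by blast
  then show "D_uuu \<phi> x \<alpha> \<beta> \<gamma> = D_uuu \<phi> x \<beta> \<alpha> \<gamma>"
    by (simp add: D_uuu_def)
  show "D_uuu \<phi> x \<alpha> \<beta> \<gamma> = D_uuu \<phi> x \<alpha> \<gamma> \<beta>"
    by (simp add: D_uuu_def pd_commute[OF smooth_pd[OF assms], of \<gamma> \<beta>])
qed

lemma hess_sq_eq: "hess_sq \<phi> x \<alpha> \<beta> = (\<Sum>\<kappa>\<in>UNIV. \<eta> \<kappa> \<kappa> * (D_uu \<phi> x \<alpha> \<kappa> * D_uu \<phi> x \<beta> \<kappa>))"
  unfolding hess_sq_def by (intro sum.cong) (auto simp: D_uu_eq D_ul_eq algebra_simps)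

lemma hess_sq_commute: "hess_sq \<phi> x \<alpha> \<beta> = hess_sq \<phi> x \<beta> \<alpha>"
  by (simp add: hess_sq_eq mult.commute)

lemma hess_norm_eq:
  "hess_norm \<phi> x = (\<Sum>\<rho>\<in>UNIV. \<Sum>\<sigma>\<in>UNIV. \<eta> \<rho> \<rho> * (\<eta> \<sigma> \<sigma> * (D_uu \<phi> x \<rho> \<sigma>)\<^sup>2))"
  unfolding hess_norm_def
  by (intro sum.cong) (auto simp: D_uu_eq D_ll_def algebra_simps power2_eq_square)

lemma grad_norm_eq: "grad_norm \<phi> x = (\<Sum>\<kappa>\<in>UNIV. \<eta> \<kappa> \<kappa> * (D_u \<phi> x \<kappa>)\<^sup>2)"
  unfolding grad_norm_def
  by (intro sum.cong) (auto simp: D_u_eq D_l_def algebra_simps power2_eq_square)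

text \<open>A coordinate derivative has a lower index while the jets are kept with upper indices;
  the sign \<open>\<eta> \<mu> \<mu>\<close> converts between them.\<close>

lemma field_has_derivative_line:
  assumes "smooth \<phi>"
  shows "((\<lambda>t. \<phi> (x + t *\<^sub>R axis \<mu> 1)) has_real_derivative \<eta> \<mu> \<mu> * D_u \<phi> x \<mu>) (at 0)"
    "((\<lambda>t. D_u \<phi> (x + t *\<^sub>R axis \<mu> 1) \<alpha>) has_real_derivative \<eta> \<mu> \<mu> * D_uu \<phi> x \<alpha> \<mu>) (at 0)"
    "((\<lambda>t. D_uu \<phi> (x + t *\<^sub>R axis \<mu> 1) \<alpha> \<beta>) has_real_derivative \<eta> \<mu> \<mu> * D_uuu \<phi> x \<alpha> \<beta> \<mu>) (at 0)"
proof -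
  have *: "((\<lambda>t. f (x + t *\<^sub>R axis \<mu> 1)) has_real_derivative pd \<mu> f x) (at 0)" if "smooth f" for f
    using has_real_derivative_pd[of f x 0] smooth_differentiable[OF that] by simp
  note d = *[OF assms] *[OF smooth_pd[OF assms]] *[OF smooth_pd[OF smooth_pd[OF assms]]]
  show "((\<lambda>t. \<phi> (x + t *\<^sub>R axis \<mu> 1)) has_real_derivative \<eta> \<mu> \<mu> * D_u \<phi> x \<mu>) (at 0)"
    using d(1) by (simp add: D_u_eq)
  show "((\<lambda>t. D_u \<phi> (x + t *\<^sub>R axis \<mu> 1) \<alpha>) has_real_derivative \<eta> \<mu> \<mu> * D_uu \<phi> x \<alpha> \<mu>) (at 0)"
    unfolding D_u_eq by (rule DERIV_cmult[OF d(2), THEN DERIV_cong]) (simp add: D_uu_eq)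
  show "((\<lambda>t. D_uu \<phi> (x + t *\<^sub>R axis \<mu> 1) \<alpha> \<beta>) has_real_derivative \<eta> \<mu> \<mu> * D_uuu \<phi> x \<alpha> \<beta> \<mu>) (at 0)"
    unfolding D_uu_eq by (rule DERIV_cmult[OF d(3), THEN DERIV_cong]) (simp add: D_uuu_def mult_ac)
qed

section \<open>Traces of the second and third derivatives of a Klein-Gordon field\<close>

lemma box_eq: "box \<phi> x = (\<Sum>\<alpha>\<in>UNIV. \<eta> \<alpha> \<alpha> * D_uu \<phi> x \<alpha> \<alpha>)"
  by (simp add: box_def sum_eta D_uu_eq)

definition klein_gordon :: "real \<Rightarrow> scalar_field \<Rightarrow> bool" where
  "klein_gordon m \<phi> \<longleftrightarrow> smooth \<phi> \<and> (\<forall>x. box \<phi> x + m\<^sup>2 * \<phi> x = 0)"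

lemma klein_gordon_trace:
  assumes "klein_gordon m \<phi>"
  shows "(\<Sum>\<alpha>\<in>UNIV. \<eta> \<alpha> \<alpha> * D_uu \<phi> x \<alpha> \<alpha>) = - m\<^sup>2 * \<phi> x"
  using assms by (simp add: klein_gordon_def box_eq eq_neg_iff_add_eq_0)

text \<open>This is the trace identity differentiated along axis \<beta>. Both sides acquire the
  sign \<open>\<eta> \<beta> \<beta>\<close>, which is removed by multiplying with it once
  more.\<close>

lemma klein_gordon_trace_deriv:
  assumes "klein_gordon m \<phi>"
  shows "(\<Sum>\<alpha>\<in>UNIV. \<eta> \<alpha> \<alpha> * D_uuu \<phi> x \<alpha> \<alpha> \<beta>) = - m\<^sup>2 * D_u \<phi> x \<beta>"
proof -
  have s: "smooth \<phi>"
    using assms by (simp add: klein_gordon_def)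
  have "((\<lambda>t. \<Sum>\<alpha>\<in>UNIV. \<eta> \<alpha> \<alpha> * D_uu \<phi> (x + t *\<^sub>R axis \<beta> 1) \<alpha> \<alpha>) has_real_derivative
      (\<Sum>\<alpha>\<in>UNIV. \<eta> \<alpha> \<alpha> * (\<eta> \<beta> \<beta> * D_uuu \<phi> x \<alpha> \<alpha> \<beta>))) (at 0)"
    by (intro DERIV_sum DERIV_cmult field_has_derivative_line s)
  moreover have "((\<lambda>t. - m\<^sup>2 * \<phi> (x + t *\<^sub>R axis \<beta> 1)) has_real_derivative
      - m\<^sup>2 * (\<eta> \<beta> \<beta> * D_u \<phi> x \<beta>)) (at 0)"
    by (intro DERIV_cmult field_has_derivative_line s)
  ultimately have "(\<Sum>\<alpha>\<in>UNIV. \<eta> \<alpha> \<alpha> * (\<eta> \<beta> \<beta> * D_uuu \<phi> x \<alpha> \<alpha> \<beta>)) = - m\<^sup>2 * (\<eta> \<beta> \<beta> * D_u \<phi> x \<beta>)"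
    unfolding klein_gordon_trace[OF assms] by (rule DERIV_unique)
  then have "\<eta> \<beta> \<beta> * (\<Sum>\<alpha>\<in>UNIV. \<eta> \<alpha> \<alpha> * D_uuu \<phi> x \<alpha> \<alpha> \<beta>) = \<eta> \<beta> \<beta> * (- m\<^sup>2 * D_u \<phi> x \<beta>)"
    by (simp add: sum_distrib_left mult_ac)
  then have "\<eta> \<beta> \<beta> * (\<eta> \<beta> \<beta> * (\<Sum>\<alpha>\<in>UNIV. \<eta> \<alpha> \<alpha> * D_uuu \<phi> x \<alpha> \<alpha> \<beta>)) = \<eta> \<beta> \<beta> * (\<eta> \<beta> \<beta> * (- m\<^sup>2 * D_u \<phi> x \<beta>))"
    by simp
  then show ?thesis
    by simp
qed

section \<open>Building blocks of the totally symmetric tensors and their derivatives\<close>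

definition rank2_part :: "real \<Rightarrow> real \<Rightarrow> scalar_field \<Rightarrow> real ^ 4 \<Rightarrow> tensor2" where
  "rank2_part c d \<phi> x \<alpha> \<beta> = c * hess_sq \<phi> x \<alpha> \<beta> + d * (D_u \<phi> x \<alpha> * D_u \<phi> x \<beta>)"

definition scalar_part :: "real \<Rightarrow> real \<Rightarrow> real \<Rightarrow> scalar_field \<Rightarrow> real ^ 4 \<Rightarrow> real" where
  "scalar_part p q r \<phi> x = p * hess_norm \<phi> x + q * grad_norm \<phi> x + r * (\<phi> x)\<^sup>2"

text \<open>Every totally symmetric tensor of the general quadratic form is of this shape; the powers of the
  mass are absorbed into \<open>d\<close>, \<open>q\<close> and \<open>r\<close>.\<close>

definition sym_tensor :: "real \<Rightarrow> real \<Rightarrow> real \<Rightarrow> real \<Rightarrow> real \<Rightarrow> real \<Rightarrow> scalar_field \<Rightarrow> real ^ 4 \<Rightarrow> tensor4"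
  where "sym_tensor a c d p q r \<phi> x \<alpha> \<beta> \<gamma> \<delta> =
    a / 3 * (D_uu \<phi> x \<alpha> \<beta> * D_uu \<phi> x \<gamma> \<delta> + D_uu \<phi> x \<alpha> \<gamma> * D_uu \<phi> x \<beta> \<delta> + D_uu \<phi> x \<alpha> \<delta> * D_uu \<phi> x \<beta> \<gamma>)
    + (\<eta> \<alpha> \<beta> * rank2_part c d \<phi> x \<gamma> \<delta> + \<eta> \<gamma> \<delta> * rank2_part c d \<phi> x \<alpha> \<beta>
       + \<eta> \<alpha> \<gamma> * rank2_part c d \<phi> x \<beta> \<delta> + \<eta> \<beta> \<delta> * rank2_part c d \<phi> x \<alpha> \<gamma>
       + \<eta> \<alpha> \<delta> * rank2_part c d \<phi> x \<beta> \<gamma> + \<eta> \<beta> \<gamma> * rank2_part c d \<phi> x \<alpha> \<delta>) / 6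
    + scalar_part p q r \<phi> x / 3 * (\<eta> \<alpha> \<beta> * \<eta> \<gamma> \<delta> + \<eta> \<alpha> \<gamma> * \<eta> \<beta> \<delta> + \<eta> \<alpha> \<delta> * \<eta> \<beta> \<gamma>)"

text \<open>Half the gradient of \<open>grad_norm\<close> for smooth fields, just as
  \<open>hess_third_trace\<close> is half the gradient of \<open>hess_norm\<close>. In
  \<open>hess_third\<close> the first free index belongs to the Hessian and the other two to the
  third derivative, so only the latter are interchangeable.\<close>

definition hess_grad :: "scalar_field \<Rightarrow> real ^ 4 \<Rightarrow> 4 \<Rightarrow> real" where
  "hess_grad \<phi> x \<beta> = (\<Sum>\<kappa>\<in>UNIV. \<eta> \<kappa> \<kappa> * (D_u \<phi> x \<kappa> * D_uu \<phi> x \<kappa> \<beta>))"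

definition hess_third :: "scalar_field \<Rightarrow> real ^ 4 \<Rightarrow> 4 \<Rightarrow> tensor2" where
  "hess_third \<phi> x \<beta> \<gamma> \<delta> = (\<Sum>\<kappa>\<in>UNIV. \<eta> \<kappa> \<kappa> * (D_uu \<phi> x \<kappa> \<beta> * D_uuu \<phi> x \<kappa> \<gamma> \<delta>))"

definition hess_third_trace :: "scalar_field \<Rightarrow> real ^ 4 \<Rightarrow> 4 \<Rightarrow> real" where
  "hess_third_trace \<phi> x \<beta> = (\<Sum>\<kappa>\<in>UNIV. \<eta> \<kappa> \<kappa> * hess_third \<phi> x \<kappa> \<kappa> \<beta>)"

lemma rank2_part_commute: "rank2_part c d \<phi> x \<alpha> \<beta> = rank2_part c d \<phi> x \<beta> \<alpha>"
  by (simp add: rank2_part_def hess_sq_commute[of \<phi> x \<alpha>])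

lemma rank2_part_has_derivative_line:
  assumes s: "smooth \<phi>"
  shows "((\<lambda>t. rank2_part c d \<phi> (x + t *\<^sub>R axis \<mu> 1) \<alpha> \<beta>) has_real_derivative
    \<eta> \<mu> \<mu> * (c * (hess_third \<phi> x \<alpha> \<beta> \<mu> + hess_third \<phi> x \<beta> \<alpha> \<mu>)
        + d * (D_uu \<phi> x \<alpha> \<mu> * D_u \<phi> x \<beta> + D_u \<phi> x \<alpha> * D_uu \<phi> x \<beta> \<mu>))) (at 0)"
proof -
  note d = field_has_derivative_line[OF s, of x \<mu>]
  \<comment> \<open>Stated exactly as the product rule returns it, with the undifferentiated factors
    still at parameter 0; the next step brings it to the named contractions.\<close>
  have "((\<lambda>t. hess_sq \<phi> (x + t *\<^sub>R axis \<mu> 1) \<alpha> \<beta>) has_real_derivative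
    (\<Sum>\<kappa>\<in>UNIV. \<eta> \<kappa> \<kappa> * (\<eta> \<mu> \<mu> * D_uuu \<phi> x \<alpha> \<kappa> \<mu> * D_uu \<phi> (x + 0 *\<^sub>R axis \<mu> 1) \<beta> \<kappa>
      + \<eta> \<mu> \<mu> * D_uuu \<phi> x \<beta> \<kappa> \<mu> * D_uu \<phi> (x + 0 *\<^sub>R axis \<mu> 1) \<alpha> \<kappa>))) (at 0)"
    unfolding hess_sq_eq
    by (intro DERIV_sum DERIV_cmult DERIV_mult d)
  also have "(\<Sum>\<kappa>\<in>UNIV. \<eta> \<kappa> \<kappa> * (\<eta> \<mu> \<mu> * D_uuu \<phi> x \<alpha> \<kappa> \<mu> * D_uu \<phi> (x + 0 *\<^sub>R axis \<mu> 1) \<beta> \<kappa>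
      + \<eta> \<mu> \<mu> * D_uuu \<phi> x \<beta> \<kappa> \<mu> * D_uu \<phi> (x + 0 *\<^sub>R axis \<mu> 1) \<alpha> \<kappa>))
    = \<eta> \<mu> \<mu> * (hess_third \<phi> x \<alpha> \<beta> \<mu> + hess_third \<phi> x \<beta> \<alpha> \<mu>)"
    unfolding hess_third_def sum.distrib[symmetric] sum_distrib_left
    by (intro sum.cong)
      (auto simp: algebra_simps D_uu_commute[OF s, of x \<alpha>] D_uu_commute[OF s, of x \<beta>]
        D_uuu_commute(1)[OF s, of x \<alpha>] D_uuu_commute(1)[OF s, of x \<beta>])
  finally have h: "((\<lambda>t. hess_sq \<phi> (x + t *\<^sub>R axis \<mu> 1) \<alpha> \<beta>) has_real_derivative
    \<eta> \<mu> \<mu> * (hess_third \<phi> x \<alpha> \<beta> \<mu> + hess_third \<phi> x \<beta> \<alpha> \<mu>)) (at 0)" .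
  show ?thesis
    unfolding rank2_part_def
    by (rule DERIV_cong[OF DERIV_add[OF DERIV_cmult[OF h] DERIV_cmult[OF DERIV_mult[OF d(2) d(2)]]]])
      (simp add: algebra_simps)
qed

lemma scalar_part_has_derivative_line:
  assumes s: "smooth \<phi>"
  shows "((\<lambda>t. scalar_part p q r \<phi> (x + t *\<^sub>R axis \<mu> 1)) has_real_derivative
    2 * \<eta> \<mu> \<mu> * (p * hess_third_trace \<phi> x \<mu> + q * hess_grad \<phi> x \<mu> + r * (\<phi> x * D_u \<phi> x \<mu>))) (at 0)"
proof -
  note d = field_has_derivative_line[OF s, of x \<mu>]
  have sq: "((\<lambda>t. (f t)\<^sup>2) has_real_derivative 2 * f 0 * f') (at 0)"
    if "(f has_real_derivative f') (at 0)" for f f'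
    using that by (auto intro!: derivative_eq_intros)
  have "((\<lambda>t. hess_norm \<phi> (x + t *\<^sub>R axis \<mu> 1)) has_real_derivative
    (\<Sum>\<rho>\<in>UNIV. \<Sum>\<sigma>\<in>UNIV. \<eta> \<rho> \<rho> * (\<eta> \<sigma> \<sigma> * (2 * D_uu \<phi> (x + 0 *\<^sub>R axis \<mu> 1) \<rho> \<sigma> * (\<eta> \<mu> \<mu> * D_uuu \<phi> x \<rho> \<sigma> \<mu>))))) (at 0)"
    unfolding hess_norm_eq by (intro DERIV_sum DERIV_cmult sq d)
  also have "(\<Sum>\<rho>\<in>UNIV. \<Sum>\<sigma>\<in>UNIV. \<eta> \<rho> \<rho> * (\<eta> \<sigma> \<sigma> * (2 * D_uu \<phi> (x + 0 *\<^sub>R axis \<mu> 1) \<rho> \<sigma> * (\<eta> \<mu> \<mu> * D_uuu \<phi> x \<rho> \<sigma> \<mu>))))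
    = 2 * \<eta> \<mu> \<mu> * hess_third_trace \<phi> x \<mu>"
    unfolding hess_third_trace_def hess_third_def sum_distrib_left
    by (intro sum.cong) (auto simp: mult_ac D_uu_commute[OF s] D_uuu_commute(1)[OF s])
  finally have h: "((\<lambda>t. hess_norm \<phi> (x + t *\<^sub>R axis \<mu> 1)) has_real_derivative
      2 * \<eta> \<mu> \<mu> * hess_third_trace \<phi> x \<mu>) (at 0)" .
  have "((\<lambda>t. grad_norm \<phi> (x + t *\<^sub>R axis \<mu> 1)) has_real_derivative
    (\<Sum>\<kappa>\<in>UNIV. \<eta> \<kappa> \<kappa> * (2 * D_u \<phi> (x + 0 *\<^sub>R axis \<mu> 1) \<kappa> * (\<eta> \<mu> \<mu> * D_uu \<phi> x \<kappa> \<mu>)))) (at 0)"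
    unfolding grad_norm_eq by (intro DERIV_sum DERIV_cmult sq d)
  also have "(\<Sum>\<kappa>\<in>UNIV. \<eta> \<kappa> \<kappa> * (2 * D_u \<phi> (x + 0 *\<^sub>R axis \<mu> 1) \<kappa> * (\<eta> \<mu> \<mu> * D_uu \<phi> x \<kappa> \<mu>)))
    = 2 * \<eta> \<mu> \<mu> * hess_grad \<phi> x \<mu>"
    unfolding hess_grad_def sum_distrib_left by (intro sum.cong) auto
  finally have g: "((\<lambda>t. grad_norm \<phi> (x + t *\<^sub>R axis \<mu> 1)) has_real_derivative
      2 * \<eta> \<mu> \<mu> * hess_grad \<phi> x \<mu>) (at 0)" .
  show ?thesis
    unfolding scalar_part_def
    by (rule DERIV_cong[OF DERIV_add[OF DERIV_add[OF DERIV_cmult[OF h] DERIV_cmult[OF g]]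
          DERIV_cmult[OF sq[OF d(1)]]]])
      (simp add: algebra_simps)
qed

section \<open>Divergence on solutions of the Klein-Gordon equation\<close>

definition divergence :: "(real ^ 4 \<Rightarrow> tensor4) \<Rightarrow> real ^ 4 \<Rightarrow> 4 \<Rightarrow> tensor2" where
  "divergence X x \<beta> \<gamma> \<delta> = (\<Sum>\<alpha>\<in>UNIV. pd \<alpha> (\<lambda>y. X y \<alpha> \<beta> \<gamma> \<delta>) x)"

text \<open>On solutions this is one sixth of the divergence of \<open>rank2_part\<close> plus one
  third of the gradient of \<open>scalar_part\<close>: what accompanies a metric with two free
  indices.\<close>

definition divergence_trace ::
    "real \<Rightarrow> real \<Rightarrow> real \<Rightarrow> real \<Rightarrow> real \<Rightarrow> real \<Rightarrow> scalar_field \<Rightarrow> real ^ 4 \<Rightarrow> 4 \<Rightarrow> real" where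
  "divergence_trace m c d p q r \<phi> x \<beta> =
    (c / 6 + 2 * p / 3) * hess_third_trace \<phi> x \<beta>
    + (- c * m\<^sup>2 / 6 + d / 6 + 2 * q / 3) * hess_grad \<phi> x \<beta>
    + (- d * m\<^sup>2 / 6 + 2 * r / 3) * (\<phi> x * D_u \<phi> x \<beta>)"

text \<open>The field equation enters only through traces. A derivative contracted with its own
  Hessian factor gives \<open>- m\<^sup>2\<close> times the gradient, hence the
  \<open>- a * m\<^sup>2\<close>. Where the metric carries the differentiated index, the derivatives
  of \<open>rank2_part\<close> produce each Hessian product twice, so 1/6 becomes the 1/3 in front
  of \<open>c\<close> and \<open>d\<close>.\<close>

lemma divergence_sym_tensor:
  assumes kg: "klein_gordon m \<phi>"
  shows "divergence (sym_tensor a c d p q r \<phi>) x \<beta> \<gamma> \<delta> =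
    (a + c) / 3 * (hess_third \<phi> x \<beta> \<gamma> \<delta> + hess_third \<phi> x \<gamma> \<beta> \<delta> + hess_third \<phi> x \<delta> \<beta> \<gamma>)
    + (d - a * m\<^sup>2) / 3 * (D_u \<phi> x \<beta> * D_uu \<phi> x \<gamma> \<delta> + D_u \<phi> x \<gamma> * D_uu \<phi> x \<beta> \<delta> + D_u \<phi> x \<delta> * D_uu \<phi> x \<beta> \<gamma>)
    + (\<eta> \<gamma> \<delta> * divergence_trace m c d p q r \<phi> x \<beta>
       + \<eta> \<beta> \<delta> * divergence_trace m c d p q r \<phi> x \<gamma>
       + \<eta> \<beta> \<gamma> * divergence_trace m c d p q r \<phi> x \<delta>)"
proof -
  have s: "smooth \<phi>"
    using kg by (simp add: klein_gordon_def)
  define B where "B = D_u \<phi> x"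
  define F where "F = D_uu \<phi> x"
  define G where "G = D_uuu \<phi> x"
  define H where "H = hess_third \<phi> x"
  define dM where "dM \<alpha> \<beta> \<mu> = c * (H \<alpha> \<beta> \<mu> + H \<beta> \<alpha> \<mu>) + d * (F \<alpha> \<mu> * B \<beta> + B \<alpha> * F \<beta> \<mu>)" for \<alpha> \<beta> \<mu>
  define dk where "dk \<mu> = p * hess_third_trace \<phi> x \<mu> + q * hess_grad \<phi> x \<mu> + r * (\<phi> x * B \<mu>)" for \<mu>
  have F_commute: "F \<alpha> \<beta> = F \<beta> \<alpha>" for \<alpha> \<beta>
    unfolding F_def by (rule D_uu_commute[OF s])
  have G_commute: "G \<alpha> \<beta> \<gamma> = G \<beta> \<alpha> \<gamma>" "G \<alpha> \<beta> \<gamma> = G \<alpha> \<gamma> \<beta>" for \<alpha> \<beta> \<gamma>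
    unfolding G_def by (rule D_uuu_commute[OF s])+
  have H_eq: "H \<beta> \<gamma> \<delta> = (\<Sum>\<alpha>\<in>UNIV. \<eta> \<alpha> \<alpha> * (F \<alpha> \<beta> * G \<gamma> \<delta> \<alpha>))" for \<beta> \<gamma> \<delta>
    unfolding H_def hess_third_def F_def[symmetric] G_def[symmetric]
    by (intro sum.cong refl) (metis G_commute)
  have H_commute: "H \<beta> \<gamma> \<delta> = H \<beta> \<delta> \<gamma>" for \<beta> \<gamma> \<delta>
    unfolding H_eq using G_commute(1)[of \<gamma> \<delta>] by simp
  have dM: "((\<lambda>t. rank2_part c d \<phi> (x + t *\<^sub>R axis \<mu> 1) \<alpha> \<beta>) has_real_derivative \<eta> \<mu> \<mu> * dM \<alpha> \<beta> \<mu>) (at 0)"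
    for \<alpha> \<beta> \<mu>
    unfolding dM_def B_def F_def H_def by (rule rank2_part_has_derivative_line[OF s])
  have dk: "((\<lambda>t. scalar_part p q r \<phi> (x + t *\<^sub>R axis \<mu> 1)) has_real_derivative 2 * \<eta> \<mu> \<mu> * dk \<mu>) (at 0)"
    for \<mu>
    unfolding dk_def B_def by (rule scalar_part_has_derivative_line[OF s])
  have dF: "((\<lambda>t. D_uu \<phi> (x + t *\<^sub>R axis \<mu> 1) \<alpha> \<beta>) has_real_derivative \<eta> \<mu> \<mu> * G \<alpha> \<beta> \<mu>) (at 0)"
    for \<mu> \<alpha> \<beta>
    unfolding G_def by (rule field_has_derivative_line[OF s])
  have dFF: "((\<lambda>t. D_uu \<phi> (x + t *\<^sub>R axis \<mu> 1) \<alpha> \<beta> * D_uu \<phi> (x + t *\<^sub>R axis \<mu> 1) \<gamma> \<delta>)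
      has_real_derivative \<eta> \<mu> \<mu> * (G \<alpha> \<beta> \<mu> * F \<gamma> \<delta> + F \<alpha> \<beta> * G \<gamma> \<delta> \<mu>)) (at 0)" for \<mu> \<alpha> \<beta> \<gamma> \<delta>
    by (rule DERIV_cong[OF DERIV_mult[OF dF dF]]) (simp add: F_def algebra_simps)
  have "pd \<mu> (\<lambda>y. sym_tensor a c d p q r \<phi> y \<alpha> \<beta> \<gamma> \<delta>) x =
    \<eta> \<mu> \<mu> * (a / 3 * (G \<alpha> \<beta> \<mu> * F \<gamma> \<delta> + F \<alpha> \<beta> * G \<gamma> \<delta> \<mu> + (G \<alpha> \<gamma> \<mu> * F \<beta> \<delta> + F \<alpha> \<gamma> * G \<beta> \<delta> \<mu>)
        + (G \<alpha> \<delta> \<mu> * F \<beta> \<gamma> + F \<alpha> \<delta> * G \<beta> \<gamma> \<mu>))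
      + (\<eta> \<alpha> \<beta> * dM \<gamma> \<delta> \<mu> + \<eta> \<gamma> \<delta> * dM \<alpha> \<beta> \<mu> + \<eta> \<alpha> \<gamma> * dM \<beta> \<delta> \<mu> + \<eta> \<beta> \<delta> * dM \<alpha> \<gamma> \<mu>
         + \<eta> \<alpha> \<delta> * dM \<beta> \<gamma> \<mu> + \<eta> \<beta> \<gamma> * dM \<alpha> \<delta> \<mu>) / 6
      + 2 * dk \<mu> / 3 * (\<eta> \<alpha> \<beta> * \<eta> \<gamma> \<delta> + \<eta> \<alpha> \<gamma> * \<eta> \<beta> \<delta> + \<eta> \<alpha> \<delta> * \<eta> \<beta> \<gamma>))" for \<mu> \<alpha>
  proof (rule pd_eqI, unfold sym_tensor_def, rule DERIV_cong)
    show "((\<lambda>t. a / 3 * (D_uu \<phi> (x + t *\<^sub>R axis \<mu> 1) \<alpha> \<beta> * D_uu \<phi> (x + t *\<^sub>R axis \<mu> 1) \<gamma> \<delta>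
           + D_uu \<phi> (x + t *\<^sub>R axis \<mu> 1) \<alpha> \<gamma> * D_uu \<phi> (x + t *\<^sub>R axis \<mu> 1) \<beta> \<delta>
           + D_uu \<phi> (x + t *\<^sub>R axis \<mu> 1) \<alpha> \<delta> * D_uu \<phi> (x + t *\<^sub>R axis \<mu> 1) \<beta> \<gamma>)
      + (\<eta> \<alpha> \<beta> * rank2_part c d \<phi> (x + t *\<^sub>R axis \<mu> 1) \<gamma> \<delta> + \<eta> \<gamma> \<delta> * rank2_part c d \<phi> (x + t *\<^sub>R axis \<mu> 1) \<alpha> \<beta>
         + \<eta> \<alpha> \<gamma> * rank2_part c d \<phi> (x + t *\<^sub>R axis \<mu> 1) \<beta> \<delta> + \<eta> \<beta> \<delta> * rank2_part c d \<phi> (x + t *\<^sub>R axis \<mu> 1) \<alpha> \<gamma>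
         + \<eta> \<alpha> \<delta> * rank2_part c d \<phi> (x + t *\<^sub>R axis \<mu> 1) \<beta> \<gamma> + \<eta> \<beta> \<gamma> * rank2_part c d \<phi> (x + t *\<^sub>R axis \<mu> 1) \<alpha> \<delta>) / 6
      + scalar_part p q r \<phi> (x + t *\<^sub>R axis \<mu> 1) / 3 * (\<eta> \<alpha> \<beta> * \<eta> \<gamma> \<delta> + \<eta> \<alpha> \<gamma> * \<eta> \<beta> \<delta> + \<eta> \<alpha> \<delta> * \<eta> \<beta> \<gamma>))
      has_real_derivative
      a / 3 * (\<eta> \<mu> \<mu> * (G \<alpha> \<beta> \<mu> * F \<gamma> \<delta> + F \<alpha> \<beta> * G \<gamma> \<delta> \<mu>) + \<eta> \<mu> \<mu> * (G \<alpha> \<gamma> \<mu> * F \<beta> \<delta> + F \<alpha> \<gamma> * G \<beta> \<delta> \<mu>)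
        + \<eta> \<mu> \<mu> * (G \<alpha> \<delta> \<mu> * F \<beta> \<gamma> + F \<alpha> \<delta> * G \<beta> \<gamma> \<mu>))
      + (\<eta> \<alpha> \<beta> * (\<eta> \<mu> \<mu> * dM \<gamma> \<delta> \<mu>) + \<eta> \<gamma> \<delta> * (\<eta> \<mu> \<mu> * dM \<alpha> \<beta> \<mu>) + \<eta> \<alpha> \<gamma> * (\<eta> \<mu> \<mu> * dM \<beta> \<delta> \<mu>)
         + \<eta> \<beta> \<delta> * (\<eta> \<mu> \<mu> * dM \<alpha> \<gamma> \<mu>)
         + \<eta> \<alpha> \<delta> * (\<eta> \<mu> \<mu> * dM \<beta> \<gamma> \<mu>) + \<eta> \<beta> \<gamma> * (\<eta> \<mu> \<mu> * dM \<alpha> \<delta> \<mu>)) / 6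
      + (2 * \<eta> \<mu> \<mu> * dk \<mu>) / 3 * (\<eta> \<alpha> \<beta> * \<eta> \<gamma> \<delta> + \<eta> \<alpha> \<gamma> * \<eta> \<beta> \<delta> + \<eta> \<alpha> \<delta> * \<eta> \<beta> \<gamma>)) (at 0)"
      by (intro DERIV_add DERIV_cmult DERIV_cdivide DERIV_cmult_right dFF dM dk)
  qed (simp add: field_simps)
  then have "divergence (sym_tensor a c d p q r \<phi>) x \<beta> \<gamma> \<delta> = (\<Sum>\<alpha>\<in>UNIV.
    \<eta> \<alpha> \<alpha> * (a / 3 * (G \<alpha> \<beta> \<alpha> * F \<gamma> \<delta> + F \<alpha> \<beta> * G \<gamma> \<delta> \<alpha> + (G \<alpha> \<gamma> \<alpha> * F \<beta> \<delta> + F \<alpha> \<gamma> * G \<beta> \<delta> \<alpha>)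
        + (G \<alpha> \<delta> \<alpha> * F \<beta> \<gamma> + F \<alpha> \<delta> * G \<beta> \<gamma> \<alpha>))
      + (\<eta> \<alpha> \<beta> * dM \<gamma> \<delta> \<alpha> + \<eta> \<gamma> \<delta> * dM \<alpha> \<beta> \<alpha> + \<eta> \<alpha> \<gamma> * dM \<beta> \<delta> \<alpha> + \<eta> \<beta> \<delta> * dM \<alpha> \<gamma> \<alpha>
         + \<eta> \<alpha> \<delta> * dM \<beta> \<gamma> \<alpha> + \<eta> \<beta> \<gamma> * dM \<alpha> \<delta> \<alpha>) / 6
      + 2 * dk \<alpha> / 3 * (\<eta> \<alpha> \<beta> * \<eta> \<gamma> \<delta> + \<eta> \<alpha> \<gamma> * \<eta> \<beta> \<delta> + \<eta> \<alpha> \<delta> * \<eta> \<beta> \<gamma>)))"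
    unfolding divergence_def by simp
  \<comment> \<open>Regrouped so that every sum over \<alpha> either is a contraction with a name or
    collapses by \<open>sum_eta_contract\<close>.\<close>
  also have "\<dots> = (\<Sum>\<alpha>\<in>UNIV.
      a / 3 * (F \<gamma> \<delta> * (\<eta> \<alpha> \<alpha> * G \<alpha> \<beta> \<alpha>) + F \<beta> \<delta> * (\<eta> \<alpha> \<alpha> * G \<alpha> \<gamma> \<alpha>) + F \<beta> \<gamma> * (\<eta> \<alpha> \<alpha> * G \<alpha> \<delta> \<alpha>)
        + \<eta> \<alpha> \<alpha> * (F \<alpha> \<beta> * G \<gamma> \<delta> \<alpha>) + \<eta> \<alpha> \<alpha> * (F \<alpha> \<gamma> * G \<beta> \<delta> \<alpha>) + \<eta> \<alpha> \<alpha> * (F \<alpha> \<delta> * G \<beta> \<gamma> \<alpha>))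
      + 1 / 6 * (\<eta> \<alpha> \<alpha> * (\<eta> \<alpha> \<beta> * dM \<gamma> \<delta> \<alpha>) + \<eta> \<alpha> \<alpha> * (\<eta> \<alpha> \<gamma> * dM \<beta> \<delta> \<alpha>) + \<eta> \<alpha> \<alpha> * (\<eta> \<alpha> \<delta> * dM \<beta> \<gamma> \<alpha>)
        + \<eta> \<gamma> \<delta> * (\<eta> \<alpha> \<alpha> * dM \<alpha> \<beta> \<alpha>) + \<eta> \<beta> \<delta> * (\<eta> \<alpha> \<alpha> * dM \<alpha> \<gamma> \<alpha>) + \<eta> \<beta> \<gamma> * (\<eta> \<alpha> \<alpha> * dM \<alpha> \<delta> \<alpha>))
      + 2 / 3 * (\<eta> \<gamma> \<delta> * (\<eta> \<alpha> \<alpha> * (\<eta> \<alpha> \<beta> * dk \<alpha>)) + \<eta> \<beta> \<delta> * (\<eta> \<alpha> \<alpha> * (\<eta> \<alpha> \<gamma> * dk \<alpha>))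
        + \<eta> \<beta> \<gamma> * (\<eta> \<alpha> \<alpha> * (\<eta> \<alpha> \<delta> * dk \<alpha>))))"
    by (intro sum.cong refl) (simp add: field_simps)
  also have "\<dots> =
      a / 3 * (F \<gamma> \<delta> * (\<Sum>\<alpha>\<in>UNIV. \<eta> \<alpha> \<alpha> * G \<alpha> \<beta> \<alpha>) + F \<beta> \<delta> * (\<Sum>\<alpha>\<in>UNIV. \<eta> \<alpha> \<alpha> * G \<alpha> \<gamma> \<alpha>)
        + F \<beta> \<gamma> * (\<Sum>\<alpha>\<in>UNIV. \<eta> \<alpha> \<alpha> * G \<alpha> \<delta> \<alpha>) + H \<beta> \<gamma> \<delta> + H \<gamma> \<beta> \<delta> + H \<delta> \<beta> \<gamma>)
      + 1 / 6 * (dM \<gamma> \<delta> \<beta> + dM \<beta> \<delta> \<gamma> + dM \<beta> \<gamma> \<delta> + \<eta> \<gamma> \<delta> * (\<Sum>\<alpha>\<in>UNIV. \<eta> \<alpha> \<alpha> * dM \<alpha> \<beta> \<alpha>)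
        + \<eta> \<beta> \<delta> * (\<Sum>\<alpha>\<in>UNIV. \<eta> \<alpha> \<alpha> * dM \<alpha> \<gamma> \<alpha>) + \<eta> \<beta> \<gamma> * (\<Sum>\<alpha>\<in>UNIV. \<eta> \<alpha> \<alpha> * dM \<alpha> \<delta> \<alpha>))
      + 2 / 3 * (\<eta> \<gamma> \<delta> * dk \<beta> + \<eta> \<beta> \<delta> * dk \<gamma> + \<eta> \<beta> \<gamma> * dk \<delta>)"
    unfolding sum.distrib sum_distrib_left[symmetric] sum_eta_contract H_eq ..
  \<comment> \<open>An equality of functions replaces the sums at \<beta>, \<gamma> and \<delta> in
    a single step.\<close>
  also have "(\<lambda>\<beta>. \<Sum>\<alpha>\<in>UNIV. \<eta> \<alpha> \<alpha> * G \<alpha> \<beta> \<alpha>) = (\<lambda>\<beta>. - m\<^sup>2 * B \<beta>)"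
    using klein_gordon_trace_deriv[OF kg, of x] G_commute(2) unfolding G_def B_def by simp
  also have "(\<lambda>\<beta>. \<Sum>\<alpha>\<in>UNIV. \<eta> \<alpha> \<alpha> * dM \<alpha> \<beta> \<alpha>) = (\<lambda>\<beta>.
      c * hess_third_trace \<phi> x \<beta> + (d - c * m\<^sup>2) * hess_grad \<phi> x \<beta> - d * m\<^sup>2 * (\<phi> x * B \<beta>))"
  proof
    fix \<beta>
    have "(\<Sum>\<alpha>\<in>UNIV. \<eta> \<alpha> \<alpha> * dM \<alpha> \<beta> \<alpha>) =
      c * (\<Sum>\<alpha>\<in>UNIV. \<eta> \<alpha> \<alpha> * H \<alpha> \<alpha> \<beta>) + c * (\<Sum>\<alpha>\<in>UNIV. \<eta> \<alpha> \<alpha> * H \<beta> \<alpha> \<alpha>)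
      + d * ((\<Sum>\<alpha>\<in>UNIV. \<eta> \<alpha> \<alpha> * F \<alpha> \<alpha>) * B \<beta>) + d * (\<Sum>\<alpha>\<in>UNIV. \<eta> \<alpha> \<alpha> * (B \<alpha> * F \<alpha> \<beta>))"
      unfolding dM_def F_commute[of \<beta>] H_commute[of _ \<beta>] sum_distrib_left sum_distrib_right
        sum.distrib[symmetric]
      by (intro sum.cong refl) (simp add: algebra_simps)
    also have "(\<Sum>\<alpha>\<in>UNIV. \<eta> \<alpha> \<alpha> * H \<alpha> \<alpha> \<beta>) = hess_third_trace \<phi> x \<beta>"
      by (simp add: hess_third_trace_def H_def)
    \<comment> \<open>After exchanging the sums, the inner one is a trace of third derivatives; this
      is the source of the \<open>- c * m\<^sup>2\<close> beside \<open>hess_grad\<close>.\<close>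
    also have "(\<Sum>\<alpha>\<in>UNIV. \<eta> \<alpha> \<alpha> * H \<beta> \<alpha> \<alpha>)
      = (\<Sum>\<kappa>\<in>UNIV. \<eta> \<kappa> \<kappa> * F \<kappa> \<beta> * (\<Sum>\<alpha>\<in>UNIV. \<eta> \<alpha> \<alpha> * G \<alpha> \<alpha> \<kappa>))"
      unfolding H_eq sum_distrib_left by (subst sum.swap) (simp add: mult_ac)
    also have "\<dots> = - m\<^sup>2 * hess_grad \<phi> x \<beta>"
      unfolding hess_grad_def sum_distrib_left G_def klein_gordon_trace_deriv[OF kg]
      by (intro sum.cong refl) (simp add: B_def F_def)
    also have "(\<Sum>\<alpha>\<in>UNIV. \<eta> \<alpha> \<alpha> * F \<alpha> \<alpha>) = - m\<^sup>2 * \<phi> x"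
      unfolding F_def by (rule klein_gordon_trace[OF kg])
    also have "(\<Sum>\<alpha>\<in>UNIV. \<eta> \<alpha> \<alpha> * (B \<alpha> * F \<alpha> \<beta>)) = hess_grad \<phi> x \<beta>"
      by (simp add: hess_grad_def B_def F_def)
    finally show "(\<Sum>\<alpha>\<in>UNIV. \<eta> \<alpha> \<alpha> * dM \<alpha> \<beta> \<alpha>) =
      c * hess_third_trace \<phi> x \<beta> + (d - c * m\<^sup>2) * hess_grad \<phi> x \<beta> - d * m\<^sup>2 * (\<phi> x * B \<beta>)"
      by (simp add: algebra_simps)
  qed
  finally show ?thesis
    unfolding divergence_trace_def dM_def dk_def B_def[symmetric] F_def[symmetric] H_def[symmetric]
    using F_commute[of \<delta> \<gamma>] F_commute[of \<delta> \<beta>] F_commute[of \<gamma> \<beta>] H_commute[of \<delta> \<gamma>]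
        H_commute[of \<gamma> \<delta> \<beta>] H_commute[of \<beta> \<delta> \<gamma>]
    by (simp add: field_simps)
qed

section \<open>The symmetrized tensors\<close>

lemma tau_eq: "tau m \<phi> x \<alpha> \<beta> = rank2_part 1 (- m\<^sup>2) \<phi> x \<alpha> \<beta> - K m \<phi> x * \<eta> \<alpha> \<beta> / 2"
  by (simp add: tau_def rank2_part_def)

lemma tau_commute: "tau m \<phi> x \<alpha> \<beta> = tau m \<phi> x \<beta> \<alpha>"
  by (simp add: tau_eq rank2_part_commute[of _ _ _ _ \<alpha>] eta_sym[of \<alpha>])

text \<open>The parameters at which all coefficients in \<open>divergence_sym_tensor\<close> vanish,
  normalized by a = 1.\<close>

abbreviation W_form :: "real \<Rightarrow> scalar_field \<Rightarrow> real ^ 4 \<Rightarrow> tensor4" where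
  "W_form m \<equiv> sym_tensor 1 (- 1) (m\<^sup>2) (1 / 4) (- m\<^sup>2 / 2) (m ^ 4 / 4)"

lemma rank2_part_uminus: "rank2_part (- c) (- d) \<phi> x \<alpha> \<beta> = - rank2_part c d \<phi> x \<alpha> \<beta>"
  by (simp add: rank2_part_def)

lemma W_form_tau:
  "W_form m \<phi> x \<alpha> \<beta> \<gamma> \<delta> =
    (D_uu \<phi> x \<alpha> \<beta> * D_uu \<phi> x \<gamma> \<delta> + D_uu \<phi> x \<alpha> \<gamma> * D_uu \<phi> x \<beta> \<delta> + D_uu \<phi> x \<alpha> \<delta> * D_uu \<phi> x \<beta> \<gamma>) / 3
    - (\<eta> \<alpha> \<beta> * tau m \<phi> x \<gamma> \<delta> + \<eta> \<gamma> \<delta> * tau m \<phi> x \<alpha> \<beta>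
       + \<eta> \<alpha> \<gamma> * tau m \<phi> x \<beta> \<delta> + \<eta> \<beta> \<delta> * tau m \<phi> x \<alpha> \<gamma>
       + \<eta> \<alpha> \<delta> * tau m \<phi> x \<beta> \<gamma> + \<eta> \<beta> \<gamma> * tau m \<phi> x \<alpha> \<delta>) / 6"
proof -
  \<comment> \<open>Each product of two metrics arises from two of the six \<open>tau\<close> terms,
    with weight K/12 each. The total K/6 is a third of this scalar part.\<close>
  have k: "scalar_part (1 / 4) (- m\<^sup>2 / 2) (m ^ 4 / 4) \<phi> x = K m \<phi> x / 2"
    by (simp add: scalar_part_def K_def field_simps)
  show ?thesis
    unfolding sym_tensor_def k tau_eq rank2_part_uminus[of 1 "- m\<^sup>2", simplified]
    by (simp add: field_simps)
qed

context
  fixes \<phi> :: scalar_field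
  assumes s: "smooth \<phi>"
begin

text \<open>In the sum over the three pairings, each of the six metric-\<open>tau\<close> products
  occurs once with weight 1/2 and twice with -1/2, so the average is -1/6.\<close>

lemma sym4_T1: "sym4 (T1 m \<phi> x) = W_form m \<phi> x"
proof (intro ext)
  fix \<alpha> \<beta> \<gamma> \<delta>
  note comm = D_uu_commute[OF s] tau_commute eta_sym
  have "sym4 (T1 m \<phi> x) \<alpha> \<beta> \<gamma> \<delta>
    = (T1 m \<phi> x \<alpha> \<beta> \<gamma> \<delta> + T1 m \<phi> x \<alpha> \<gamma> \<beta> \<delta> + T1 m \<phi> x \<alpha> \<delta> \<beta> \<gamma>) / 3"
  proof (rule sym4_eq)
    fix \<alpha> \<beta> \<gamma> \<delta>
    show "T1 m \<phi> x \<beta> \<alpha> \<gamma> \<delta> = T1 m \<phi> x \<alpha> \<beta> \<gamma> \<delta>" "T1 m \<phi> x \<alpha> \<beta> \<delta> \<gamma> = T1 m \<phi> x \<alpha> \<beta> \<gamma> \<delta>"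
      "T1 m \<phi> x \<gamma> \<delta> \<alpha> \<beta> = T1 m \<phi> x \<alpha> \<beta> \<gamma> \<delta>"
      unfolding T1_def sym2_def
      using comm(1)[of x \<beta> \<alpha>] comm(1)[of x \<delta> \<gamma>] comm(2)[of m \<phi> x \<beta> \<alpha>] comm(2)[of m \<phi> x \<delta> \<gamma>]
        comm(2)[of m \<phi> x \<gamma> \<beta>] comm(2)[of m \<phi> x \<delta> \<beta>] comm(2)[of m \<phi> x \<gamma> \<alpha>] comm(2)[of m \<phi> x \<delta> \<alpha>]
        eta_sym[of \<beta> \<alpha>] eta_sym[of \<delta> \<gamma>] eta_sym[of \<gamma> \<alpha>] eta_sym[of \<delta> \<alpha>] eta_sym[of \<gamma> \<beta>] eta_sym[of \<delta> \<beta>]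
      by (simp_all add: field_simps)
  qed
  then show "sym4 (T1 m \<phi> x) \<alpha> \<beta> \<gamma> \<delta> = W_form m \<phi> x \<alpha> \<beta> \<gamma> \<delta>"
    unfolding T1_def sym2_def W_form_tau
    using comm(1)[of x \<gamma> \<beta>] comm(1)[of x \<delta> \<beta>] comm(1)[of x \<delta> \<gamma>]
      comm(2)[of m \<phi> x \<beta> \<alpha>] comm(2)[of m \<phi> x \<gamma> \<alpha>] comm(2)[of m \<phi> x \<delta> \<alpha>]
      comm(2)[of m \<phi> x \<gamma> \<beta>] comm(2)[of m \<phi> x \<delta> \<beta>] comm(2)[of m \<phi> x \<delta> \<gamma>]
      eta_sym[of \<gamma> \<beta>] eta_sym[of \<delta> \<beta>] eta_sym[of \<delta> \<gamma>]
    by (simp add: field_simps)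
qed

text \<open>Here each metric-\<open>tau\<close> product occurs only once, with weight -1/2, which
  again averages to -1/6. Each Hessian product receives 1/2 from two pairings, so it also ends with
  the same 1/3 as for \<open>T1\<close>.\<close>

lemma sym4_T2: "sym4 (T2 m \<phi> x) = W_form m \<phi> x"
proof (intro ext)
  fix \<alpha> \<beta> \<gamma> \<delta>
  note comm = D_uu_commute[OF s] tau_commute eta_sym
  have "sym4 (T2 m \<phi> x) \<alpha> \<beta> \<gamma> \<delta>
    = (T2 m \<phi> x \<alpha> \<beta> \<gamma> \<delta> + T2 m \<phi> x \<alpha> \<gamma> \<beta> \<delta> + T2 m \<phi> x \<alpha> \<delta> \<beta> \<gamma>) / 3"
  proof (rule sym4_eq)
    fix \<alpha> \<beta> \<gamma> \<delta>
    show "T2 m \<phi> x \<beta> \<alpha> \<gamma> \<delta> = T2 m \<phi> x \<alpha> \<beta> \<gamma> \<delta>" "T2 m \<phi> x \<alpha> \<beta> \<delta> \<gamma> = T2 m \<phi> x \<alpha> \<beta> \<gamma> \<delta>"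
      "T2 m \<phi> x \<gamma> \<delta> \<alpha> \<beta> = T2 m \<phi> x \<alpha> \<beta> \<gamma> \<delta>"
      unfolding T2_def sym2_def
      using comm(1)[of x \<gamma> \<alpha>] comm(1)[of x \<delta> \<alpha>] comm(1)[of x \<gamma> \<beta>] comm(1)[of x \<delta> \<beta>]
        comm(2)[of m \<phi> x \<beta> \<alpha>] comm(2)[of m \<phi> x \<delta> \<gamma>]
        eta_sym[of \<beta> \<alpha>] eta_sym[of \<delta> \<gamma>]
      by (simp_all add: field_simps)
  qed
  then show "sym4 (T2 m \<phi> x) \<alpha> \<beta> \<gamma> \<delta> = W_form m \<phi> x \<alpha> \<beta> \<gamma> \<delta>"
    unfolding T2_def sym2_def W_form_tau
    using comm(1)[of x \<gamma> \<beta>] comm(1)[of x \<delta> \<beta>] comm(1)[of x \<delta> \<gamma>]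
      comm(2)[of m \<phi> x \<gamma> \<beta>] comm(2)[of m \<phi> x \<delta> \<beta>] comm(2)[of m \<phi> x \<delta> \<gamma>]
      eta_sym[of \<gamma> \<beta>] eta_sym[of \<delta> \<beta>] eta_sym[of \<delta> \<gamma>]
    by (simp add: field_simps)
qed

lemma W_eq_W_form: "W m \<phi> x = W_form m \<phi> x"
  by (simp add: W_def sym4_T1)

lemma W_explicit:
  "W m \<phi> x \<alpha> \<beta> \<gamma> \<delta> =
    (D_uu \<phi> x \<alpha> \<beta> * D_uu \<phi> x \<gamma> \<delta>
      + 2 * sym2 (\<lambda>i j. D_uu \<phi> x \<alpha> i * D_uu \<phi> x j \<beta>) \<gamma> \<delta>) / 3
    - (\<eta> \<alpha> \<beta> * tau m \<phi> x \<gamma> \<delta> + \<eta> \<gamma> \<delta> * tau m \<phi> x \<alpha> \<beta>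
       + 2 * sym2 (\<lambda>i j. \<eta> \<alpha> i * tau m \<phi> x j \<beta>) \<gamma> \<delta>
       + 2 * sym2 (\<lambda>i j. \<eta> \<beta> i * tau m \<phi> x j \<alpha>) \<gamma> \<delta>) / 6"
  unfolding W_eq_W_form W_form_tau sym2_def
  using D_uu_commute[OF s, of x \<gamma> \<beta>] D_uu_commute[OF s, of x \<delta> \<beta>]
    tau_commute[of m \<phi> x \<beta> \<gamma>] tau_commute[of m \<phi> x \<beta> \<delta>] tau_commute[of m \<phi> x \<alpha> \<gamma>] tau_commute[of m \<phi> x \<alpha> \<delta>]
  by (simp add: field_simps)

end

section \<open>Passage between the twelve-constant form and \<open>sym_tensor\<close>\<close>

lemma quadratic_form_W:
  assumes "\<And>\<phi> x \<alpha> \<beta> \<gamma> \<delta>. smooth \<phi> \<Longrightarrow> T \<phi> x \<alpha> \<beta> \<gamma> \<delta> = k * W m \<phi> x \<alpha> \<beta> \<gamma> \<delta>"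
  shows "quadratic_form m T"
  unfolding quadratic_form_def
proof (intro exI allI impI)
  fix \<phi> x \<alpha> \<beta> \<gamma> \<delta> assume s: "smooth \<phi>"
  \<comment> \<open>This formula supplies the existential witnesses. The general form separates the
    pairing (\<alpha>\<beta>)(\<gamma>\<delta>) from the two crossed ones, so each constant of k
    times W is shared between them in the ratio 1:2.\<close>
  show "T \<phi> x \<alpha> \<beta> \<gamma> \<delta> =
    (k / 3) * D_uu \<phi> x \<alpha> \<beta> * D_uu \<phi> x \<gamma> \<delta>
    + (2 * k / 3) * sym2 (\<lambda>i j. D_uu \<phi> x \<gamma> i * D_uu \<phi> x j \<delta>) \<alpha> \<beta>
    + (- k / 3) / 2 * (\<eta> \<alpha> \<beta> * hess_sq \<phi> x \<gamma> \<delta> + \<eta> \<gamma> \<delta> * hess_sq \<phi> x \<alpha> \<beta>)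
    + (- k / 3) * (sym2 (\<lambda>i j. \<eta> \<gamma> i * hess_sq \<phi> x j \<delta>) \<alpha> \<beta>
            + sym2 (\<lambda>i j. \<eta> \<delta> i * hess_sq \<phi> x j \<gamma>) \<alpha> \<beta>)
    + (k / 3) / 2 * m^2 * (\<eta> \<alpha> \<beta> * D_u \<phi> x \<gamma> * D_u \<phi> x \<delta>
                      + \<eta> \<gamma> \<delta> * D_u \<phi> x \<alpha> * D_u \<phi> x \<beta>)
    + (k / 3) * m^2 * (sym2 (\<lambda>i j. \<eta> \<gamma> i * D_u \<phi> x j * D_u \<phi> x \<delta>) \<alpha> \<beta>
                  + sym2 (\<lambda>i j. \<eta> \<delta> i * D_u \<phi> x j * D_u \<phi> x \<gamma>) \<alpha> \<beta>)
    + Kgen m (k / 6) (- k / 3) (k / 6) \<phi> x / 2 * \<eta> \<alpha> \<beta> * \<eta> \<gamma> \<delta>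
    + Kgen m (k / 6) (- k / 3) (k / 6) \<phi> x * sym2 (\<lambda>i j. \<eta> \<gamma> i * \<eta> j \<delta>) \<alpha> \<beta>"
    unfolding assms[OF s] W_eq_W_form[OF s] sym_tensor_def rank2_part_def scalar_part_def Kgen_def sym2_def
    using D_uu_commute[OF s, of x \<gamma> \<alpha>] D_uu_commute[OF s, of x \<gamma> \<beta>] D_uu_commute[OF s, of x \<delta> \<beta>]
      eta_sym[of \<gamma> \<alpha>] eta_sym[of \<gamma> \<beta>] eta_sym[of \<delta> \<alpha>] eta_sym[of \<delta> \<beta>]
    by (simp add: field_simps)
qed

text \<open>Averaging merges the aligned and the crossed constants, leaving sums such as a + b and
  c1 + 2 * c2. Nothing is claimed about the individual constants.\<close>

lemma quadratic_form_imp_sym_tensor: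
  assumes "quadratic_form m T" and T: "\<And>\<phi> x. smooth \<phi> \<Longrightarrow> totally_symmetric (T \<phi> x)"
  obtains a c d p q r where
    "\<And>\<phi> x. smooth \<phi> \<Longrightarrow> T \<phi> x = sym_tensor a c (d * m\<^sup>2) p (q * m\<^sup>2) (r * m ^ 4) \<phi> x"
proof -
  obtain a b c1 c2 d1 d2 p1 q1 r1 p2 q2 r2 where T_eq:
    "\<And>\<phi> x \<alpha> \<beta> \<gamma> \<delta>. smooth \<phi> \<Longrightarrow>
         T \<phi> x \<alpha> \<beta> \<gamma> \<delta> =
           a * D_uu \<phi> x \<alpha> \<beta> * D_uu \<phi> x \<gamma> \<delta>
           + b * sym2 (\<lambda>i j. D_uu \<phi> x \<gamma> i * D_uu \<phi> x j \<delta>) \<alpha> \<beta>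
           + c1 / 2 * (\<eta> \<alpha> \<beta> * hess_sq \<phi> x \<gamma> \<delta> + \<eta> \<gamma> \<delta> * hess_sq \<phi> x \<alpha> \<beta>)
           + c2 * (sym2 (\<lambda>i j. \<eta> \<gamma> i * hess_sq \<phi> x j \<delta>) \<alpha> \<beta>
                   + sym2 (\<lambda>i j. \<eta> \<delta> i * hess_sq \<phi> x j \<gamma>) \<alpha> \<beta>)
           + d1 / 2 * m^2 * (\<eta> \<alpha> \<beta> * D_u \<phi> x \<gamma> * D_u \<phi> x \<delta>
                             + \<eta> \<gamma> \<delta> * D_u \<phi> x \<alpha> * D_u \<phi> x \<beta>)
           + d2 * m^2 * (sym2 (\<lambda>i j. \<eta> \<gamma> i * D_u \<phi> x j * D_u \<phi> x \<delta>) \<alpha> \<beta>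
                         + sym2 (\<lambda>i j. \<eta> \<delta> i * D_u \<phi> x j * D_u \<phi> x \<gamma>) \<alpha> \<beta>)
           + Kgen m p1 q1 r1 \<phi> x / 2 * \<eta> \<alpha> \<beta> * \<eta> \<gamma> \<delta>
           + Kgen m p2 q2 r2 \<phi> x * sym2 (\<lambda>i j. \<eta> \<gamma> i * \<eta> j \<delta>) \<alpha> \<beta>"
    using assms(1) unfolding quadratic_form_def by metis
  have "T \<phi> x = sym_tensor (a + b) (c1 + 2 * c2) ((d1 + 2 * d2) * m\<^sup>2) (p1 / 2 + p2)
    ((q1 / 2 + q2) * m\<^sup>2) ((r1 / 2 + r2) * m ^ 4) \<phi> x" if s: "smooth \<phi>" for \<phi> x
  proof (intro ext)
    fix \<alpha> \<beta> \<gamma> \<delta>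
    have "T \<phi> x \<alpha> \<beta> \<gamma> \<delta> = (T \<phi> x \<alpha> \<beta> \<gamma> \<delta> + T \<phi> x \<alpha> \<gamma> \<beta> \<delta> + T \<phi> x \<alpha> \<delta> \<beta> \<gamma>) / 3"
      by (rule totally_symmetric_average[OF T[OF s]])
    also have "\<dots> = sym_tensor (a + b) (c1 + 2 * c2) ((d1 + 2 * d2) * m\<^sup>2) (p1 / 2 + p2)
        ((q1 / 2 + q2) * m\<^sup>2) ((r1 / 2 + r2) * m ^ 4) \<phi> x \<alpha> \<beta> \<gamma> \<delta>"
      unfolding T_eq[OF s] sym_tensor_def rank2_part_def scalar_part_def Kgen_def sym2_def
      using D_uu_commute[OF s, of x \<beta> \<alpha>] D_uu_commute[OF s, of x \<gamma> \<alpha>] D_uu_commute[OF s, of x \<delta> \<alpha>]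
        D_uu_commute[OF s, of x \<gamma> \<beta>] D_uu_commute[OF s, of x \<delta> \<beta>] D_uu_commute[OF s, of x \<delta> \<gamma>]
        hess_sq_commute[of \<phi> x \<beta> \<alpha>] hess_sq_commute[of \<phi> x \<gamma> \<alpha>] hess_sq_commute[of \<phi> x \<delta> \<alpha>]
        hess_sq_commute[of \<phi> x \<gamma> \<beta>] hess_sq_commute[of \<phi> x \<delta> \<beta>] hess_sq_commute[of \<phi> x \<delta> \<gamma>]
        eta_sym[of \<beta> \<alpha>] eta_sym[of \<gamma> \<alpha>] eta_sym[of \<delta> \<alpha>] eta_sym[of \<gamma> \<beta>] eta_sym[of \<delta> \<beta>] eta_sym[of \<delta> \<gamma>]
      by (simp add: field_simps)
    finally show "T \<phi> x \<alpha> \<beta> \<gamma> \<delta> = sym_tensor (a + b) (c1 + 2 * c2) ((d1 + 2 * d2) * m\<^sup>2) (p1 / 2 + p2)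
        ((q1 / 2 + q2) * m\<^sup>2) ((r1 / 2 + r2) * m ^ 4) \<phi> x \<alpha> \<beta> \<gamma> \<delta>" .
  qed
  then show thesis
    by (rule that)
qed

section \<open>Hyperbolic wave solutions\<close>

text \<open>Four coefficients make the family closed under \<open>pd\<close>, which reduces
  smoothness and all jets to bookkeeping of coefficients. The product \<open>k \<bullet> x\<close>
  is Euclidean, so k has lower indices.\<close>

definition wave_family :: "real ^ 4 \<Rightarrow> real ^ 4 \<Rightarrow> real \<Rightarrow> real \<Rightarrow> real \<Rightarrow> real \<Rightarrow> scalar_field" where
  "wave_family k l a b c d x = a * cosh (k \<bullet> x) + b * sinh (k \<bullet> x) + c * cosh (l \<bullet> x) + d * sinh (l \<bullet> x)"

lemma wave_family_has_derivative:
  "(wave_family k l a b c d has_derivative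
     (\<lambda>h. (b * cosh (k \<bullet> x) + a * sinh (k \<bullet> x)) * (k \<bullet> h) + (d * cosh (l \<bullet> x) + c * sinh (l \<bullet> x)) * (l \<bullet> h))) (at x)"
proof -
  have lin: "((\<lambda>x. v \<bullet> x) has_derivative (\<lambda>h. v \<bullet> h)) (at x)" for v :: "real ^ 4"
    by (rule bounded_linear_imp_has_derivative[OF bounded_linear_inner_right])
  have c: "((\<lambda>x. cosh (v \<bullet> x)) has_derivative (\<lambda>h. v \<bullet> h * sinh (v \<bullet> x))) (at x)"
    and s: "((\<lambda>x. sinh (v \<bullet> x)) has_derivative (\<lambda>h. v \<bullet> h * cosh (v \<bullet> x))) (at x)" for v :: "real ^ 4"
    by (rule DERIV_compose_FDERIV[OF _ lin], auto intro!: derivative_eq_intros)+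
  show ?thesis
    unfolding wave_family_def [abs_def]
    by (rule has_derivative_eq_rhs, (rule has_derivative_add has_derivative_mult_right c s)+)
      (simp add: fun_eq_iff algebra_simps)
qed

lemma pd_wave_family:
  "pd \<alpha> (wave_family k l a b c d) = wave_family k l (b * k $ \<alpha>) (a * k $ \<alpha>) (d * l $ \<alpha>) (c * l $ \<alpha>)"
  by (rule ext) (simp add: pd_eq_derivative[OF wave_family_has_derivative] inner_axis wave_family_def algebra_simps)

lemma smooth_wave_family: "smooth (wave_family k l a b c d)"
  unfolding smooth_def
proof (intro allI)
  fix \<alpha>s x
  have "\<exists>a' b' c' d'. iter_pd \<alpha>s (wave_family k l a b c d) = wave_family k l a' b' c' d'"
    by (induction \<alpha>s) (force simp: pd_wave_family)+
  then obtain a' b' c' d' where "iter_pd \<alpha>s (wave_family k l a b c d) = wave_family k l a' b' c' d'"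
    by blast
  then show "iter_pd \<alpha>s (wave_family k l a b c d) differentiable at x"
    by (simp add: differentiableI[OF wave_family_has_derivative])
qed

definition minkowski :: "real ^ 4 \<Rightarrow> real ^ 4 \<Rightarrow> real" where
  "minkowski k l = (\<Sum>\<kappa>\<in>UNIV. \<eta> \<kappa> \<kappa> * (k $ \<kappa> * l $ \<kappa>))"

text \<open>Two derivatives of a hyperbolic function reproduce it without the sign change of the
  cosine, whence the norm \<open>- m\<^sup>2\<close>.\<close>

lemma klein_gordon_wave_family:
  assumes "minkowski k k = - m\<^sup>2" "minkowski l l = - m\<^sup>2"
  shows "klein_gordon m (wave_family k l a b c d)"
proof -
  have "box (wave_family k l a b c d) x + m\<^sup>2 * wave_family k l a b c d x = 0" for x
  proof -
    have "box (wave_family k l a b c d) x =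
      (\<Sum>\<alpha>\<in>UNIV. \<eta> \<alpha> \<alpha> * (k $ \<alpha> * k $ \<alpha>)) * (a * cosh (k \<bullet> x) + b * sinh (k \<bullet> x))
      + (\<Sum>\<alpha>\<in>UNIV. \<eta> \<alpha> \<alpha> * (l $ \<alpha> * l $ \<alpha>)) * (c * cosh (l \<bullet> x) + d * sinh (l \<bullet> x))"
      unfolding box_def sum_eta pd_wave_family sum_distrib_right sum.distrib[symmetric]
      by (intro sum.cong refl) (simp add: wave_family_def algebra_simps)
    then show ?thesis
      using assms by (simp add: minkowski_def wave_family_def algebra_simps)
  qed
  then show ?thesis
    by (simp add: klein_gordon_def smooth_wave_family)
qed

text \<open>At the origin the even jet of this solution depends only on \<open>k\<close> and the odd one only on \<open>l\<close>.\<close>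

abbreviation wave :: "real ^ 4 \<Rightarrow> real ^ 4 \<Rightarrow> scalar_field" where
  "wave k l \<equiv> wave_family k l 1 0 0 1"

lemma wave_jet:
  "wave k l 0 = 1" "D_u (wave k l) 0 \<alpha> = \<eta> \<alpha> \<alpha> * l $ \<alpha>"
  "D_uu (wave k l) 0 \<alpha> \<beta> = (\<eta> \<alpha> \<alpha> * k $ \<alpha>) * (\<eta> \<beta> \<beta> * k $ \<beta>)"
  "D_uuu (wave k l) 0 \<alpha> \<beta> \<gamma> = (\<eta> \<alpha> \<alpha> * l $ \<alpha>) * (\<eta> \<beta> \<beta> * l $ \<beta>) * (\<eta> \<gamma> \<gamma> * l $ \<gamma>)"
  by (simp_all add: D_u_eq D_uu_eq D_uuu_def pd_wave_family) (simp_all add: wave_family_def)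

text \<open>All three contractions carry the factor \<open>minkowski k l\<close>. Orthogonal k and l
  therefore leave only the products of \<open>D_u\<close> with \<open>D_uu\<close> and with the
  field itself.\<close>

lemma wave_contractions:
  "hess_third (wave k l) 0 \<beta> \<gamma> \<delta> = minkowski k l * (\<eta> \<beta> \<beta> * k $ \<beta>) * (\<eta> \<gamma> \<gamma> * l $ \<gamma>) * (\<eta> \<delta> \<delta> * l $ \<delta>)"
  "hess_grad (wave k l) 0 \<beta> = minkowski k l * (\<eta> \<beta> \<beta> * k $ \<beta>)"
  "hess_third_trace (wave k l) 0 \<beta> = (minkowski k l)\<^sup>2 * (\<eta> \<beta> \<beta> * l $ \<beta>)"
proof -
  show h: "hess_third (wave k l) 0 \<beta> \<gamma> \<delta> = minkowski k l * (\<eta> \<beta> \<beta> * k $ \<beta>) * (\<eta> \<gamma> \<gamma> * l $ \<gamma>) * (\<eta> \<delta> \<delta> * l $ \<delta>)"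
    for \<beta> \<gamma> \<delta>
    unfolding hess_third_def wave_jet minkowski_def sum_distrib_right
    by (intro sum.cong refl) (simp add: mult_ac)
  show "hess_grad (wave k l) 0 \<beta> = minkowski k l * (\<eta> \<beta> \<beta> * k $ \<beta>)"
    unfolding hess_grad_def wave_jet minkowski_def sum_distrib_right
    by (intro sum.cong refl) (simp add: mult_ac)
  have "hess_third_trace (wave k l) 0 \<beta>
      = (\<Sum>\<kappa>\<in>UNIV. \<eta> \<kappa> \<kappa> * (k $ \<kappa> * l $ \<kappa>)) * (minkowski k l * (\<eta> \<beta> \<beta> * l $ \<beta>))"
    unfolding hess_third_trace_def h sum_distrib_right
    by (intro sum.cong refl) (simp add: mult_ac)
  then show "hess_third_trace (wave k l) 0 \<beta> = (minkowski k l)\<^sup>2 * (\<eta> \<beta> \<beta> * l $ \<beta>)"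
    by (simp add: minkowski_def power2_eq_square)
qed

text \<open>The components \<open>(0, 1, 2)\<close> of the divergence contain no metric term, and those with indices
  \<open>(0, 2, 2)\<close> isolate the trace part. Evaluating them at the origin on waves with suitable Minkowski
  products of \<open>k\<close> and \<open>l\<close> determines one coefficient at a time. As \<open>n\<^sup>2 = 1 + m\<^sup>2\<close>, the vectors \<open>u\<close>
  and \<open>v\<close> also serve in the massless case, where \<open>e1\<close> and \<open>e2\<close> vanish.\<close>

lemma conserved_sym_tensor_coeffs:
  assumes div: "\<And>\<phi> \<beta> \<gamma> \<delta>. klein_gordon m \<phi> \<Longrightarrow>
    divergence (sym_tensor a c (d * m\<^sup>2) p (q * m\<^sup>2) (r * m ^ 4) \<phi>) 0 \<beta> \<gamma> \<delta> = 0"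
  shows "c = - a" "d * m\<^sup>2 = a * m\<^sup>2" "p = a / 4" "q * m\<^sup>2 = - a * m\<^sup>2 / 2" "r * m ^ 4 = a * m ^ 4 / 4"
proof -
  define n where "n = sqrt (1 + m\<^sup>2)"
  have n: "n * n = 1 + m\<^sup>2" "n \<noteq> 0"
    unfolding n_def by (auto simp: add_nonneg_eq_0_iff)
  define u v e1 e2 :: "real ^ 4" where
    "u = axis 0 1 + axis 1 n" and "v = axis 0 1 + axis 2 n" and "e1 = axis 1 m" and "e2 = axis 2 m"
  have comp: "u $ 0 = 1" "u $ 1 = n" "u $ 2 = 0" "u $ 3 = 0" "v $ 0 = 1" "v $ 1 = 0" "v $ 2 = n" "v $ 3 = 0"
    "e1 $ 0 = 0" "e1 $ 1 = m" "e1 $ 2 = 0" "e1 $ 3 = 0" "e2 $ 0 = 0" "e2 $ 1 = 0" "e2 $ 2 = m" "e2 $ 3 = 0"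
    unfolding u_def v_def e1_def e2_def by (simp_all add: axis_def)
  have eta: "\<eta> 0 0 = 1" "\<eta> 1 1 = - 1" "\<eta> 2 2 = - 1" "\<eta> 3 3 = - 1" "\<eta> 0 1 = 0" "\<eta> 0 2 = 0" "\<eta> 1 2 = 0"
    by (simp_all add: eta_def)
  \<comment> \<open>\<open>sum_4\<close> runs over the indices 1 to 4, and 4 is the time index 0 of
    this type.\<close>
  have four: "(4 :: 4) = 0"
    by simp
  have norms: "minkowski u u = - m\<^sup>2" "minkowski v v = - m\<^sup>2" "minkowski e1 e1 = - m\<^sup>2" "minkowski e2 e2 = - m\<^sup>2"
    and prods: "minkowski u e2 = 0" "minkowski u v = 1" "minkowski e2 u = 0" "minkowski u e1 = - (n * m)"
    unfolding minkowski_def sum_4 four by (simp_all add: comp eta n power2_eq_square)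
  \<comment> \<open>Orthogonality of u and \<open>e2\<close> removes the third-derivative terms; of
    the rest only \<open>e2\<close> at index 2 times u at 0 and 1 survives. If m = 0, the conclusion
    drawn from it is trivial.\<close>
  have 1: "(d * m\<^sup>2 - a * m\<^sup>2) * (m * n) = 0"
    using div[OF klein_gordon_wave_family[OF norms(1,4)], of 1 0 0 1 0 1 2]
    unfolding divergence_sym_tensor[OF klein_gordon_wave_family[OF norms(1,4)]]
      divergence_trace_def wave_jet wave_contractions prods
    by (simp add: eta comp)
  then show d: "d * m\<^sup>2 = a * m\<^sup>2"
    using n by auto
  have 2: "(a + c) * (n * n) = 0"
    using div[OF klein_gordon_wave_family[OF norms(1,2)], of 1 0 0 1 0 1 2]
    unfolding divergence_sym_tensor[OF klein_gordon_wave_family[OF norms(1,2)]]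
      divergence_trace_def wave_jet wave_contractions prods d
    by (simp add: eta comp)
  then show c: "c = - a"
    using n by auto
  \<comment> \<open>With k = \<open>e2\<close> orthogonal to l = u, only the field times its
    gradient remains in the trace part, and u has time component 1.\<close>
  have 3: "4 * (r * m ^ 4) = a * m ^ 4"
    using div[OF klein_gordon_wave_family[OF norms(4,1)], of 1 0 0 1 0 2 2]
    unfolding divergence_sym_tensor[OF klein_gordon_wave_family[OF norms(4,1)]]
      divergence_trace_def wave_jet wave_contractions prods d c
    by (auto simp: eta comp power4_eq_xxxx power2_eq_square)
  then show r: "r * m ^ 4 = a * m ^ 4 / 4"
    by linarith
  \<comment> \<open>The time component of l = \<open>e1\<close> is 0, which removes the other two
    trace terms and leaves \<open>hess_grad\<close>. The factor m is harmless, since the bracket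
    vanishes for m = 0 anyway.\<close>
  have 4: "(- c * m\<^sup>2 / 6 + (d * m\<^sup>2) / 6 + 2 * (q * m\<^sup>2) / 3) * (n * m) = 0"
    using div[OF klein_gordon_wave_family[OF norms(1,3)], of 1 0 0 1 0 2 2]
    unfolding divergence_sym_tensor[OF klein_gordon_wave_family[OF norms(1,3)]]
      divergence_trace_def wave_jet wave_contractions prods d c
    by (simp add: eta comp)
  have "m = 0 \<or> - c * m\<^sup>2 / 6 + (d * m\<^sup>2) / 6 + 2 * (q * m\<^sup>2) / 3 = 0"
    using 4 n by auto
  then have 5: "- c * m\<^sup>2 / 6 + (d * m\<^sup>2) / 6 + 2 * (q * m\<^sup>2) / 3 = 0"
    by auto
  then show "q * m\<^sup>2 = - a * m\<^sup>2 / 2"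
    unfolding d c by (simp add: field_simps)
  have 6: "- (d * m\<^sup>2) * m\<^sup>2 / 6 + 2 * (r * m ^ 4) / 3 = 0"
    unfolding d r by (simp add: power4_eq_xxxx power2_eq_square)
  have "c / 6 + 2 * p / 3 = 0"
    using div[OF klein_gordon_wave_family[OF norms(1,2)], of 1 0 0 1 0 2 2]
    unfolding divergence_sym_tensor[OF klein_gordon_wave_family[OF norms(1,2)]]
      divergence_trace_def 5 6 wave_jet wave_contractions prods
    by (simp add: eta comp c d)
  then show "p = a / 4"
    unfolding c by simp
qed

section \<open>Characterization of the totally symmetric superenergy tensors\<close>

lemma scale_W_form:
  "sym_tensor k (- k) (k * m\<^sup>2) (k / 4) (- k * m\<^sup>2 / 2) (k * m ^ 4 / 4) \<phi> x \<alpha> \<beta> \<gamma> \<delta>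
    = k * W_form m \<phi> x \<alpha> \<beta> \<gamma> \<delta>"
  by (simp add: sym_tensor_def rank2_part_def scalar_part_def field_simps)

lemma conserved_alt:
  "conserved m T \<longleftrightarrow> (\<forall>\<phi> x \<beta> \<gamma> \<delta>. klein_gordon m \<phi> \<longrightarrow> divergence (T \<phi>) x \<beta> \<gamma> \<delta> = 0)"
  unfolding conserved_def klein_gordon_def divergence_def by blast

lemma conserved_W:
  assumes "\<And>\<phi> x \<alpha> \<beta> \<gamma> \<delta>. smooth \<phi> \<Longrightarrow> T \<phi> x \<alpha> \<beta> \<gamma> \<delta> = k * W m \<phi> x \<alpha> \<beta> \<gamma> \<delta>"
  shows "conserved m T"
  unfolding conserved_alt
proof (intro allI impI)
  fix \<phi> x \<beta> \<gamma> \<delta> assume kg: "klein_gordon m \<phi>"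
  then have s: "smooth \<phi>"
    by (simp add: klein_gordon_def)
  have T: "T \<phi> = sym_tensor k (- k) (k * m\<^sup>2) (k / 4) (- k * m\<^sup>2 / 2) (k * m ^ 4 / 4) \<phi>"
    by (intro ext) (simp only: assms[OF s] W_eq_W_form[OF s] scale_W_form)
  show "divergence (T \<phi>) x \<beta> \<gamma> \<delta> = 0"
    unfolding T divergence_sym_tensor[OF kg]
    by (simp add: divergence_trace_def field_simps power4_eq_xxxx power2_eq_square)
qed

lemma totally_symmetric_scale:
  assumes "totally_symmetric X"
  shows "totally_symmetric (\<lambda>\<alpha> \<beta> \<gamma> \<delta>. k * X \<alpha> \<beta> \<gamma> \<delta>)"
proof -
  have "permute_slots \<pi> (\<lambda>\<alpha> \<beta> \<gamma> \<delta>. k * X \<alpha> \<beta> \<gamma> \<delta>) = (\<lambda>\<alpha> \<beta> \<gamma> \<delta>. k * permute_slots \<pi> X \<alpha> \<beta> \<gamma> \<delta>)" for \<pi>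
    by (intro ext) (simp add: permute_slots_def Let_def)
  then show ?thesis
    using assms by (simp add: totally_symmetric_def)
qed

lemma symmetric_superenergy_imp_W:
  assumes "superenergy_tensor m T" and T: "\<And>\<phi> x. smooth \<phi> \<Longrightarrow> totally_symmetric (T \<phi> x)"
  shows "\<exists>k. \<forall>\<phi> x \<alpha> \<beta> \<gamma> \<delta>. smooth \<phi> \<longrightarrow> T \<phi> x \<alpha> \<beta> \<gamma> \<delta> = k * W m \<phi> x \<alpha> \<beta> \<gamma> \<delta>"
proof -
  obtain a c d p q r where eq:
    "\<And>\<phi> x. smooth \<phi> \<Longrightarrow> T \<phi> x = sym_tensor a c (d * m\<^sup>2) p (q * m\<^sup>2) (r * m ^ 4) \<phi> x"
    using quadratic_form_imp_sym_tensor[of m T] assms unfolding superenergy_tensor_def by metis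
  have div: "divergence (sym_tensor a c (d * m\<^sup>2) p (q * m\<^sup>2) (r * m ^ 4) \<phi>) 0 \<beta> \<gamma> \<delta> = 0"
    if kg: "klein_gordon m \<phi>" for \<phi> \<beta> \<gamma> \<delta>
  proof -
    have "T \<phi> = sym_tensor a c (d * m\<^sup>2) p (q * m\<^sup>2) (r * m ^ 4) \<phi>"
      using kg eq by (auto simp: klein_gordon_def)
    moreover have "divergence (T \<phi>) 0 \<beta> \<gamma> \<delta> = 0"
      using assms(1) kg unfolding superenergy_tensor_def conserved_alt by blast
    ultimately show ?thesis
      by simp
  qed
  \<comment> \<open>For m = 0 the equations with powers of m read 0 = 0, but T contains
    \<open>d\<close>, \<open>q\<close> and \<open>r\<close> only in these products.\<close>
  have coeffs: "c = - a" "d * m\<^sup>2 = a * m\<^sup>2" "p = a / 4" "q * m\<^sup>2 = - a * m\<^sup>2 / 2" "r * m ^ 4 = a * m ^ 4 / 4"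
    by (rule conserved_sym_tensor_coeffs; fact div)+
  have "T \<phi> x \<alpha> \<beta> \<gamma> \<delta> = a * W m \<phi> x \<alpha> \<beta> \<gamma> \<delta>" if s: "smooth \<phi>" for \<phi> x \<alpha> \<beta> \<gamma> \<delta>
    unfolding eq[OF s] coeffs scale_W_form W_eq_W_form[OF s] ..
  then show ?thesis
    by blast
qed

theorem theorem3:
  fixes m :: real
  assumes "m \<ge> 0"
  shows
    "(\<forall>T. superenergy_tensor m T \<and> (\<forall>\<phi> x. smooth \<phi> \<longrightarrow> totally_symmetric (T \<phi> x)) \<longleftrightarrow>
        (\<exists>k. \<forall>\<phi> x \<alpha> \<beta> \<gamma> \<delta>. smooth \<phi> \<longrightarrow> T \<phi> x \<alpha> \<beta> \<gamma> \<delta> = k * W m \<phi> x \<alpha> \<beta> \<gamma> \<delta>))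
     \<and> (\<forall>\<phi> x \<alpha> \<beta> \<gamma> \<delta>. smooth \<phi> \<longrightarrow>
          W m \<phi> x \<alpha> \<beta> \<gamma> \<delta> = sym4 (T1 m \<phi> x) \<alpha> \<beta> \<gamma> \<delta> \<and>
          W m \<phi> x \<alpha> \<beta> \<gamma> \<delta> = sym4 (T2 m \<phi> x) \<alpha> \<beta> \<gamma> \<delta> \<and>
          W m \<phi> x \<alpha> \<beta> \<gamma> \<delta> =
            (D_uu \<phi> x \<alpha> \<beta> * D_uu \<phi> x \<gamma> \<delta>
              + 2 * sym2 (\<lambda>i j. D_uu \<phi> x \<alpha> i * D_uu \<phi> x j \<beta>) \<gamma> \<delta>) / 3
            - (\<eta> \<alpha> \<beta> * tau m \<phi> x \<gamma> \<delta> + \<eta> \<gamma> \<delta> * tau m \<phi> x \<alpha> \<beta>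
               + 2 * sym2 (\<lambda>i j. \<eta> \<alpha> i * tau m \<phi> x j \<beta>) \<gamma> \<delta>
               + 2 * sym2 (\<lambda>i j. \<eta> \<beta> i * tau m \<phi> x j \<alpha>) \<gamma> \<delta>) / 6)"
proof (intro conjI allI impI iffI)
  fix T
  assume "superenergy_tensor m T \<and> (\<forall>\<phi> x. smooth \<phi> \<longrightarrow> totally_symmetric (T \<phi> x))"
  then show "\<exists>k. \<forall>\<phi> x \<alpha> \<beta> \<gamma> \<delta>. smooth \<phi> \<longrightarrow> T \<phi> x \<alpha> \<beta> \<gamma> \<delta> = k * W m \<phi> x \<alpha> \<beta> \<gamma> \<delta>"
    using symmetric_superenergy_imp_W by blast
next
  fix T
  assume "\<exists>k. \<forall>\<phi> x \<alpha> \<beta> \<gamma> \<delta>. smooth \<phi> \<longrightarrow> T \<phi> x \<alpha> \<beta> \<gamma> \<delta> = k * W m \<phi> x \<alpha> \<beta> \<gamma> \<delta>"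
  then obtain k where T: "\<And>\<phi> x \<alpha> \<beta> \<gamma> \<delta>. smooth \<phi> \<Longrightarrow> T \<phi> x \<alpha> \<beta> \<gamma> \<delta> = k * W m \<phi> x \<alpha> \<beta> \<gamma> \<delta>"
    by blast
  show "superenergy_tensor m T"
    using quadratic_form_W[OF T] conserved_W[OF T] by (simp add: superenergy_tensor_def)
  fix \<phi> x assume s: "smooth \<phi>"
  have "T \<phi> x = (\<lambda>\<alpha> \<beta> \<gamma> \<delta>. k * W m \<phi> x \<alpha> \<beta> \<gamma> \<delta>)"
    by (intro ext T s)
  then show "totally_symmetric (T \<phi> x)"
    unfolding W_def by (simp add: totally_symmetric_scale totally_symmetric_sym4)
next
  fix \<phi> x \<alpha> \<beta> \<gamma> \<delta> assume s: "smooth \<phi>"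
  show "W m \<phi> x \<alpha> \<beta> \<gamma> \<delta> = sym4 (T1 m \<phi> x) \<alpha> \<beta> \<gamma> \<delta>"
    by (simp add: W_def)
  show "W m \<phi> x \<alpha> \<beta> \<gamma> \<delta> = sym4 (T2 m \<phi> x) \<alpha> \<beta> \<gamma> \<delta>"
    by (simp add: W_eq_W_form[OF s] sym4_T2[OF s])
qed (rule W_explicit)

end
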